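(* Let $\mathcal H$ be a complex separable Hilbert space, let $S$ be a bounded antilinear involution on $\mathcal H$ with polar decomposition $S=J\Delta^{1/2}$, and let $\mathcal I_2$ be the Hilbert space of Hilbert--Schmidt operators on $\mathcal H\otimes\mathcal H$. (a) Any Hilbert--Schmidt operator is $S$-crossable for any bounded antilinear involution $S$, i.e. $\mathcal I_2\subset\mathcal C_b$. The $J$-crossing map $\mathrm{Cr}_J$ restricts to a unitary on $\mathcal I_2$, and the $S$-crossing map $\mathrm{Cr}_S$ restricts to a bounded bijection on $\mathcal I_2$. (b) In restriction to $\mathcal I_2\subset\mathcal C_b$, $$\widehat S|_{\mathcal I_2}=\widehat J|_{\mathcal I_2}\,\widehat\Delta_{1/2}|_{\mathcal I_2}$$ is the polar decomposition of $\widehat S|_{\mathcal I_2}$. Hence $\widehat H\cap\mathcal I_2$ is a standard subspace of the Hilbert space $\mathcal I_2$, with Tomita operator $\widehat S|_{\mathcal I_2}$.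
   Context: Inner products are antilinear in the first and linear in the second argument. For a bounded antilinear involution $S$ on $\mathcal H$ the polar decomposition $S=J\Delta^{1/2}$ has $J$ an antiunitary involution, $\Delta$ bounded, positive and boundedly invertible, $J\Delta=\Delta^{-1}J$; $S^*$ is defined by $\langle v,Sw\rangle=\langle w,S^*v\rangle$. An operator $T\in\mathcal B(\mathcal H\otimes\mathcal H)$ is $S$-crossable if there is a (unique) $\mathrm{Cr}_S(T)\in\mathcal B(\mathcal H\otimes\mathcal H)$ with $$\langle\varphi_2\otimes S^*\psi_2,\,T(S\varphi_1\otimes\psi_1)\rangle=\langle\varphi_1\otimes\varphi_2,\,\mathrm{Cr}_S(T)(\psi_1\otimes\psi_2)\rangle\quad\text{for all }\varphi_1,\varphi_2,\psi_1,\psi_2\in\mathcal H.$$ The set of $S$-crossable operators is the same for all bounded antilinear involutions $S$ on $\mathcal H$ (including $J$) and is denoted $\mathcal C_b$. On $\mathcal C_b$ define $\widehat S(T):=\mathrm{Cr}_S(T)^*$, $\widehat J(T):=\mathrm{Cr}_J(T)^*$, $\widehat\Delta_\alpha(T):=(1\otimes\Delta^\alpha)T(\Delta^{-\alpha}\otimes1)$, and $\widehat H:=\ker(\widehat S-1)=\{T\in\mathcal C_b:\mathrm{Cr}_S(T)=T^*\}$. A standard subspace of a complex Hilbert space $\mathcal K$ is a closed real linear subspace $K$ with $K\cap iK=\{0\}$ and $\overline{K+iK}=\mathcal K$; its Tomita operator is the closed antilinear involution $K+iK\to K+iK$, $h_1+ih_2\mapsto h_1-ih_2$ ($h_1,h_2\in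 K$). $\mathcal I_2$ carries the Hilbert--Schmidt scalar product. *)

theory Defs
  imports "HOL-Analysis.Analysis"
begin

section \<open>Complex inner product spaces and Hilbert spaces\<close>

text \<open>
  The complex inner product is antilinear in the first argument. Norm, metric and topology
  are those of the underlying real inner product space, whose inner product is the real part
  of the complex one.
\<close>

class complex_inner = real_inner +
  fixes scaleC :: "complex \<Rightarrow> 'a \<Rightarrow> 'a" (infixr "*\<^sub>C" 75)
    and cinner :: "'a \<Rightarrow> 'a \<Rightarrow> complex"
  assumes scaleR_scaleC: "r *\<^sub>R x = complex_of_real r *\<^sub>C x"
    and scaleC_add_right: "c *\<^sub>C (x + y) = c *\<^sub>C x + c *\<^sub>C y"
    and scaleC_add_left: "(c + d) *\<^sub>C x = c *\<^sub>C x + d *\<^sub>C x"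
    and scaleC_scaleC: "c *\<^sub>C d *\<^sub>C x = (c * d) *\<^sub>C x"
    and cinner_commute: "cinner x y = cnj (cinner y x)"
    and cinner_add_left: "cinner (x + y) z = cinner x z + cinner y z"
    and cinner_scaleC_left: "cinner (c *\<^sub>C x) y = cnj c * cinner x y"
    and inner_cinner: "inner x y = Re (cinner x y)"

class chilbert_space = complex_inner + complete_space

lemma scaleC_one [simp]: "1 *\<^sub>C (x::'a::complex_inner) = x"
  using scaleR_scaleC[of 1 x] by simp

lemma scaleC_zero_left [simp]: "0 *\<^sub>C (x::'a::complex_inner) = 0"
  using scaleR_scaleC[of 0 x] by simp

lemma scaleC_zero_right [simp]: "c *\<^sub>C (0::'a::complex_inner) = 0"
  using scaleC_add_right[of c "0::'a" 0] by simp

lemma scaleC_minus_right: "c *\<^sub>C (- x) = - (c *\<^sub>C (x::'a::complex_inner))"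
  using scaleC_add_right[of c x "- x"] by (simp add: eq_neg_iff_add_eq_0 add.commute)

lemma scaleC_diff_right: "c *\<^sub>C (x - y) = c *\<^sub>C x - c *\<^sub>C (y::'a::complex_inner)"
  using scaleC_add_right[of c x "- y"] by (simp add: scaleC_minus_right)

lemma scaleC_sum_right: "c *\<^sub>C (\<Sum>i\<in>I. f i) = (\<Sum>i\<in>I. c *\<^sub>C (f i :: 'a::complex_inner))"
  by (induction I rule: infinite_finite_induct) (auto simp: scaleC_add_right)

lemma cinner_add_right: "cinner x (y + z) = cinner x y + cinner (x::'a::complex_inner) z"
  by (metis cinner_add_left cinner_commute complex_cnj_add)

lemma cinner_scaleC_right: "cinner x (c *\<^sub>C y) = c * cinner (x::'a::complex_inner) y"
  by (metis cinner_scaleC_left cinner_commute complex_cnj_cnj complex_cnj_mult)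

lemma cinner_zero_left [simp]: "cinner 0 (y::'a::complex_inner) = 0"
  using cinner_add_left[of "0::'a" 0 y] by simp

lemma cinner_zero_right [simp]: "cinner (y::'a::complex_inner) 0 = 0"
  using cinner_add_right[of y "0::'a" 0] by simp

lemma cinner_sum_right: "cinner x (\<Sum>i\<in>I. f i) = (\<Sum>i\<in>I. cinner (x::'a::complex_inner) (f i))"
  by (induction I rule: infinite_finite_induct) (auto simp: cinner_add_right)

lemma cinner_self: "cinner x x = complex_of_real ((norm (x::'a::complex_inner))\<^sup>2)"
proof -
  have "Im (cinner x x) = 0"
    using cinner_commute[of x x] by (metis complex_cnj complex.sel(2) neg_equal_zero complex_surj)
  moreover have "Re (cinner x x) = (norm x)\<^sup>2"
    by (simp add: power2_norm_eq_inner inner_cinner)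
  ultimately show ?thesis
    by (simp add: complex_eq_iff)
qed

lemma norm_scaleC: "norm (c *\<^sub>C x) = cmod c * norm (x::'a::complex_inner)"
proof -
  have "complex_of_real ((norm (c *\<^sub>C x))\<^sup>2) = cnj c * c * complex_of_real ((norm x)\<^sup>2)"
    by (metis (no_types) cinner_self cinner_scaleC_left cinner_scaleC_right mult.assoc)
  also have "cnj c * c = complex_of_real ((cmod c)\<^sup>2)"
    by (metis complex_norm_square mult.commute of_real_power)
  finally have "(norm (c *\<^sub>C x))\<^sup>2 = (cmod c * norm x)\<^sup>2"
    by (metis of_real_mult of_real_eq_iff power_mult_distrib)
  thus ?thesis
    by (metis mult_nonneg_nonneg norm_ge_zero power2_eq_iff_nonneg)
qed

lemma norm_cinner_le: "cmod (cinner x y) \<le> norm x * norm (y::'a::complex_inner)"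
proof (cases "cinner x y = 0")
  case False
  define u where "u = cnj (cinner x y) / cmod (cinner x y)"
  have u: "cmod u = 1"
    using False by (simp add: u_def norm_divide)
  have "u * cinner x y = complex_of_real (cmod (cinner x y))"
    using False complex_norm_square[of "cinner x y"]
    by (simp add: u_def power2_eq_square mult.commute nonzero_divide_eq_eq)
  hence "cmod (cinner x y) = inner x (u *\<^sub>C y)"
    by (simp add: inner_cinner cinner_scaleC_right)
  also have "\<dots> \<le> norm x * norm (u *\<^sub>C y)"
    by (rule norm_cauchy_schwarz)
  finally show ?thesis
    by (simp add: norm_scaleC u)
qed simp

lemma tendsto_scaleC:
  "(f \<longlongrightarrow> l) F \<Longrightarrow> ((\<lambda>n. c *\<^sub>C f n) \<longlongrightarrow> c *\<^sub>C (l::'a::complex_inner)) F"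
proof -
  have "bounded_linear (\<lambda>x::'a. c *\<^sub>C x)"
    by (rule bounded_linear_intro[where K = "cmod c"])
      (auto simp: scaleC_add_right norm_scaleC scaleR_scaleC scaleC_scaleC mult.commute)
  thus "(f \<longlongrightarrow> l) F \<Longrightarrow> ?thesis"
    by (rule bounded_linear.tendsto)
qed

section \<open>Bounded linear and antilinear operators\<close>

definition bounded_clinear :: "('a::complex_inner \<Rightarrow> 'b::complex_inner) \<Rightarrow> bool" where
  "bounded_clinear T \<longleftrightarrow> bounded_linear T \<and> (\<forall>c x. T (c *\<^sub>C x) = c *\<^sub>C T x)"

definition bounded_antilinear :: "('a::complex_inner \<Rightarrow> 'b::complex_inner) \<Rightarrow> bool" where
  "bounded_antilinear T \<longleftrightarrow> bounded_linear T \<and> (\<forall>c x. T (c *\<^sub>C x) = cnj c *\<^sub>C T x)"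

definition bounded_antilinear_involution :: "('a::complex_inner \<Rightarrow> 'a) \<Rightarrow> bool" where
  "bounded_antilinear_involution S \<longleftrightarrow> bounded_antilinear S \<and> (\<forall>x. S (S x) = x)"

definition cadjoint :: "('a::complex_inner \<Rightarrow> 'a) \<Rightarrow> 'a \<Rightarrow> 'a" where
  "cadjoint T = (THE A. \<forall>v w. cinner (A v) w = cinner v (T w))"

definition antilinear_adjoint :: "('a::complex_inner \<Rightarrow> 'a) \<Rightarrow> 'a \<Rightarrow> 'a" where
  "antilinear_adjoint S = (THE A. \<forall>v w. cinner v (S w) = cinner w (A v))"

definition positive_op :: "('a::complex_inner \<Rightarrow> 'a) \<Rightarrow> bool" where
  "positive_op P \<longleftrightarrow>
    bounded_clinear P \<and> (\<forall>x. Im (cinner x (P x)) = 0 \<and> 0 \<le> Re (cinner x (P x)))"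

definition op_sqrt :: "('a::complex_inner \<Rightarrow> 'a) \<Rightarrow> 'a \<Rightarrow> 'a" where
  "op_sqrt A = (THE B. positive_op B \<and> B \<circ> B = A)"

definition unitary :: "('a::complex_inner \<Rightarrow> 'b::complex_inner) \<Rightarrow> bool" where
  "unitary U \<longleftrightarrow> bounded_clinear U \<and> (\<forall>x y. cinner (U x) (U y) = cinner x y) \<and> surj U"

definition partial_isometry :: "('a::complex_inner \<Rightarrow> 'a) \<Rightarrow> bool" where
  "partial_isometry U \<longleftrightarrow>
    (\<forall>x. (\<forall>y. U y = 0 \<longrightarrow> cinner y x = 0) \<longrightarrow> norm (U x) = norm x)"

text \<open>
  Polar decomposition \<open>A = U P\<close> of a bounded antilinear operator: the positive factor is
  linear, and the phase is an antilinear partial isometry with the same kernel as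
  \<open>P\<close> (equivalently, as \<open>A\<close>). This determines \<open>U\<close> and \<open>P\<close>; for invertible \<open>A\<close>, in
  particular for an involution, \<open>P\<close> is invertible and \<open>U\<close> antiunitary.
\<close>

definition antilinear_polar_decomposition ::
    "('a::complex_inner \<Rightarrow> 'a) \<Rightarrow> ('a \<Rightarrow> 'a) \<Rightarrow> ('a \<Rightarrow> 'a) \<Rightarrow> bool" where
  "antilinear_polar_decomposition A U P \<longleftrightarrow>
    bounded_antilinear A \<and> bounded_antilinear U \<and> partial_isometry U \<and> positive_op P \<and>
    A = U \<circ> P \<and> {x. U x = 0} = {x. P x = 0}"

section \<open>Standard subspaces\<close>

definition standard_subspace :: "'a::complex_inner set \<Rightarrow> bool" where
  "standard_subspace K \<longleftrightarrow>
    subspace K \<and> closed K \<and> K \<inter> (*\<^sub>C) \<i> ` K = {0} \<and>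
    closure {h + \<i> *\<^sub>C k |h k. h \<in> K \<and> k \<in> K} = UNIV"

text \<open>The Tomita operator has domain \<open>K + iK\<close>; it is represented by its graph.\<close>

definition tomita_graph :: "'a::complex_inner set \<Rightarrow> ('a \<times> 'a) set" where
  "tomita_graph K = {(h + \<i> *\<^sub>C k, h - \<i> *\<^sub>C k) |h k. h \<in> K \<and> k \<in> K}"

section \<open>Orthonormal bases\<close>

definition orthonormal :: "'a::complex_inner set \<Rightarrow> bool" where
  "orthonormal E \<longleftrightarrow> (\<forall>x\<in>E. \<forall>y\<in>E. cinner x y = (if x = y then 1 else 0))"

definition cspan :: "'a::complex_inner set \<Rightarrow> 'a set" where
  "cspan E = span {c *\<^sub>C e |c e. e \<in> E}"

definition orthonormal_basis :: "'a::complex_inner set \<Rightarrow> bool" where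
  "orthonormal_basis E \<longleftrightarrow> orthonormal E \<and> closure (cspan E) = UNIV"

lemma scaleC_cspan:
  assumes "x \<in> cspan E"
  shows "c *\<^sub>C x \<in> cspan E"
  using assms unfolding cspan_def
proof (induction rule: span_induct_alt)
  case base
  show ?case by (simp add: span_zero)
next
  case (step a x y)
  then obtain d e where x: "x = d *\<^sub>C e" "e \<in> E" by auto
  have "c *\<^sub>C a *\<^sub>R x \<in> span {c *\<^sub>C e |c e. e \<in> E}"
    by (rule span_base) (use x in \<open>auto simp: scaleR_scaleC scaleC_scaleC\<close>)
  thus ?case
    using step by (simp add: scaleC_add_right span_add)
qed

lemma ex_orthogonal_to_closed_subspace:
  fixes M :: "'a::{real_inner, complete_space} set"
  assumes M: "subspace M" "closed M" and x: "x \<notin> M"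
  shows "\<exists>z. z \<noteq> 0 \<and> (\<forall>m\<in>M. inner z m = 0)"
proof -
  have ne: "M \<noteq> {}" using subspace_0[OF M(1)] by auto
  define d where "d = infdist x M"
  have d0: "d \<ge> 0" by (simp add: d_def infdist_nonneg)
  have dle: "d \<le> norm (x - m)" if "m \<in> M" for m
    using infdist_le[OF that, of x] by (simp add: d_def dist_norm)
  have "\<exists>p\<in>M. norm (x - p) < d + inverse (real (Suc n))" for n
  proof (rule ccontr)
    assume "\<not> ?thesis"
    hence "d + inverse (real (Suc n)) \<le> infdist x M"
      unfolding infdist_notempty[OF ne] using ne
      by (intro cINF_greatest) (auto simp: dist_norm not_less)
    thus False by (simp add: d_def)
  qed
  then obtain p where pM: "\<And>n. p n \<in> M"
    and p: "\<And>n. norm (x - p n) < d + inverse (real (Suc n))" by metis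
  have key: "(norm (p m - p n))\<^sup>2 \<le> (8 * d + 4) * inverse (real (Suc N))"
    if "N \<le> m" "N \<le> n" for m n N
  proof -
    let ?r = "inverse (real (Suc N))"
    have r: "0 \<le> ?r" "?r \<le> 1" by (auto simp: field_simps)
    have b: "(norm (x - p k))\<^sup>2 \<le> (d + ?r)\<^sup>2" if "N \<le> k" for k
    proof -
      have "inverse (real (Suc k)) \<le> ?r"
        using that by (intro le_imp_inverse_le) auto
      hence "norm (x - p k) \<le> d + ?r" using p[of k] by linarith
      thus ?thesis by (intro power_mono) auto
    qed
    have "(1/2) *\<^sub>R (p m + p n) \<in> M"
      using pM M(1) by (simp add: subspace_add subspace_scale)
    hence "d\<^sup>2 \<le> (norm (x - (1/2) *\<^sub>R (p m + p n)))\<^sup>2"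
      using dle d0 by (intro power_mono) auto
    moreover have "(norm (p m - p n))\<^sup>2 =
        2 * (norm (x - p m))\<^sup>2 + 2 * (norm (x - p n))\<^sup>2 - 4 * (norm (x - (1/2) *\<^sub>R (p m + p n)))\<^sup>2"
      by (simp add: power2_norm_eq_inner inner_simps inner_commute algebra_simps)
    ultimately have "(norm (p m - p n))\<^sup>2 \<le> 4 * (d + ?r)\<^sup>2 - 4 * d\<^sup>2"
      using b[OF that(1)] b[OF that(2)] by linarith
    also have "\<dots> = 8 * d * ?r + 4 * (?r * ?r)"
      by (simp add: power2_eq_square algebra_simps)
    also have "?r * ?r \<le> ?r * 1" by (rule mult_left_mono) (use r in auto)
    finally show ?thesis by (simp add: algebra_simps)
  qed
  have "Cauchy p"
  proof (rule metric_CauchyI)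
    fix e :: real assume e: "0 < e"
    have "(\<lambda>N. (8 * d + 4) * inverse (real (Suc N))) \<longlonglongrightarrow> (8 * d + 4) * 0"
      by (intro tendsto_mult_left LIMSEQ_inverse_real_of_nat)
    hence "eventually (\<lambda>N. (8 * d + 4) * inverse (real (Suc N)) < e\<^sup>2) sequentially"
      using e by (intro order_tendstoD) auto
    then obtain N where N: "(8 * d + 4) * inverse (real (Suc N)) < e\<^sup>2"
      by (auto simp: eventually_sequentially)
    show "\<exists>N. \<forall>m\<ge>N. \<forall>n\<ge>N. dist (p m) (p n) < e"
    proof (intro exI allI impI)
      fix m n assume "N \<le> m" "N \<le> n"
      hence "(norm (p m - p n))\<^sup>2 < e\<^sup>2" using key[of N m n] N by linarith
      thus "dist (p m) (p n) < e" using e by (simp add: dist_norm power_less_imp_less_base)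
    qed
  qed
  then obtain q where q: "p \<longlonglongrightarrow> q" by (auto simp: Cauchy_convergent_iff convergent_def)
  have qM: "q \<in> M" using closed_sequentially[OF M(2)] pM q by blast
  have "norm (x - q) \<le> d + 0"
  proof (rule LIMSEQ_le)
    show "(\<lambda>n. norm (x - p n)) \<longlonglongrightarrow> norm (x - q)" by (intro tendsto_intros q)
    show "(\<lambda>n. d + inverse (real (Suc n))) \<longlonglongrightarrow> d + 0"
      by (intro tendsto_add tendsto_const LIMSEQ_inverse_real_of_nat)
    show "\<exists>N. \<forall>n\<ge>N. norm (x - p n) \<le> d + inverse (real (Suc n))"
      using p by (meson less_imp_le)
  qed
  hence zle: "norm (x - q) \<le> norm (x - q - m)" if "m \<in> M" for m
    using dle[OF subspace_add[OF M(1) qM that]] by (simp add: diff_diff_add)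
  have "inner (x - q) m = 0" if m: "m \<in> M" for m
  proof (cases "m = 0")
    case False
    define t where "t = inner (x - q) m / inner m m"
    have "norm (x - q) \<le> norm (x - q - t *\<^sub>R m)"
      by (rule zle) (use m M(1) subspace_scale in blast)
    hence "(norm (x - q))\<^sup>2 \<le> (norm (x - q - t *\<^sub>R m))\<^sup>2"
      by (intro power_mono) auto
    also have "\<dots> = (norm (x - q))\<^sup>2 - 2 * t * inner (x - q) m + t * t * inner m m"
      by (simp add: power2_norm_eq_inner inner_diff_left inner_diff_right inner_commute
          algebra_simps)
    also have "\<dots> = (norm (x - q))\<^sup>2 - (inner (x - q) m)\<^sup>2 / inner m m"
      using False by (simp add: t_def power2_eq_square field_simps)
    finally have "(inner (x - q) m)\<^sup>2 / inner m m \<le> 0" by simp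
    moreover have "inner m m > 0" using False by simp
    ultimately show ?thesis by (simp add: divide_le_0_iff)
  qed simp
  moreover have "x - q \<noteq> 0" using qM x by auto
  ultimately show ?thesis by blast
qed

lemma subspace_closure:
  fixes M :: "'a::real_normed_vector set"
  assumes M: "subspace M"
  shows "subspace (closure M)"
  unfolding subspace_def
proof (intro conjI ballI allI)
  show "0 \<in> closure M"
    using subspace_0[OF M] closure_subset by blast
next
  fix x y assume "x \<in> closure M" "y \<in> closure M"
  then obtain f g where "\<And>n. f n \<in> M" "f \<longlonglongrightarrow> x" "\<And>n. g n \<in> M" "g \<longlonglongrightarrow> y"
    unfolding closure_sequential by metis
  hence "(\<forall>n. f n + g n \<in> M) \<and> (\<lambda>n. f n + g n) \<longlonglongrightarrow> x + y"
    using M by (auto intro: tendsto_add subspace_add)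
  thus "x + y \<in> closure M"
    unfolding closure_sequential by (intro exI[of _ "\<lambda>n. f n + g n"])
next
  fix c x assume "x \<in> closure M"
  then obtain f where "\<And>n. f n \<in> M" "f \<longlonglongrightarrow> x"
    unfolding closure_sequential by metis
  hence "(\<forall>n. c *\<^sub>R f n \<in> M) \<and> (\<lambda>n. c *\<^sub>R f n) \<longlonglongrightarrow> c *\<^sub>R x"
    using M by (auto intro: tendsto_scaleR subspace_scale)
  thus "c *\<^sub>R x \<in> closure M"
    unfolding closure_sequential by (intro exI[of _ "\<lambda>n. c *\<^sub>R f n"])
qed

lemma ex_orthonormal_basis: "\<exists>E::'a::chilbert_space set. orthonormal_basis E"
proof -
  have "\<exists>M\<in>Collect orthonormal. \<forall>X\<in>Collect orthonormal. M \<subseteq> X \<longrightarrow> X = (M::'a set)"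
  proof (rule Zorn_Lemma, rule ballI)
    fix C :: "'a set set" assume C: "C \<in> chains (Collect orthonormal)"
    have "\<exists>A\<in>C. x \<in> A \<and> y \<in> A" if "x \<in> \<Union>C" "y \<in> \<Union>C" for x y
      using that C unfolding chains_def chain_subset_def by blast
    moreover have "orthonormal A" if "A \<in> C" for A
      using that C unfolding chains_def by blast
    ultimately show "\<Union>C \<in> Collect orthonormal"
      unfolding orthonormal_def mem_Collect_eq by meson
  qed
  then obtain E :: "'a set" where E: "orthonormal E"
    and max: "\<And>X. orthonormal X \<Longrightarrow> E \<subseteq> X \<Longrightarrow> X = E" by blast
  have "closure (cspan E) = UNIV"
  proof (rule ccontr)
    assume "closure (cspan E) \<noteq> UNIV"
    then obtain x where "x \<notin> closure (cspan E)" by blast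
    moreover have "subspace (closure (cspan E))"
      by (simp add: subspace_closure cspan_def)
    ultimately obtain z where z: "z \<noteq> 0" "\<And>m. m \<in> closure (cspan E) \<Longrightarrow> inner z m = 0"
      using ex_orthogonal_to_closed_subspace[of "closure (cspan E)" x] by auto
    have zE: "cinner z e = 0" if e: "e \<in> E" for e
    proof -
      have m: "c *\<^sub>C e \<in> closure (cspan E)" for c
        by (rule subsetD[OF closure_subset]) (use e in \<open>auto simp: cspan_def intro: span_base\<close>)
      have "Re (cinner z e) = 0" using z(2)[OF m[of 1]] by (simp add: inner_cinner)
      moreover have "Im (cinner z e) = 0"
        using z(2)[OF m[of \<i>]] by (simp add: inner_cinner cinner_scaleC_right)
      ultimately show ?thesis by (simp add: complex_eq_iff)
    qed
    define u where "u = complex_of_real (1 / norm z) *\<^sub>C z"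
    have uE: "cinner u e = 0" "cinner e u = 0" if "e \<in> E" for e
      using zE[OF that] cinner_commute[of e z]
      by (auto simp: u_def cinner_scaleC_left cinner_scaleC_right)
    have uu: "cinner u u = 1"
      using z(1) by (simp add: cinner_self) (simp add: u_def norm_scaleC norm_divide)
    have "orthonormal (insert u E)"
      using E uE uu unfolding orthonormal_def by (auto split: if_splits)
    hence "u \<in> E" using max[of "insert u E"] by auto
    thus False using uE(1)[of u] uu by simp
  qed
  thus ?thesis using E unfolding orthonormal_basis_def by blast
qed

definition some_onb :: "'a::chilbert_space set" where
  "some_onb = (SOME E. orthonormal_basis E)"

lemma orthonormal_basis_some_onb: "orthonormal_basis some_onb"
  unfolding some_onb_def by (rule someI_ex[OF ex_orthonormal_basis])

section \<open>The Hilbert space of Hilbert-Schmidt operators\<close>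

text \<open>
  The Hilbert-Schmidt condition and the scalar product \<open>\<langle>A, B\<rangle> = Tr (A\<^sup>* B)\<close> are evaluated in a
  fixed orthonormal basis; neither depends on that choice.
\<close>

definition hilbert_schmidt :: "('a::chilbert_space \<Rightarrow> 'a) \<Rightarrow> bool" where
  "hilbert_schmidt T \<longleftrightarrow>
    bounded_clinear T \<and> (\<lambda>e. (norm (T e))\<^sup>2) summable_on some_onb"

lemma cspan_expansion:
  fixes E :: "'a::complex_inner set"
  assumes E: "orthonormal E" and x: "x \<in> cspan E"
  shows "\<exists>F. finite F \<and> F \<subseteq> E \<and> x = (\<Sum>e\<in>F. cinner e x *\<^sub>C e)"
proof -
  define Q where "Q G x \<longleftrightarrow> x = (\<Sum>e\<in>G. cinner e x *\<^sub>C e)" for G and x :: 'a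
  define P where "P x \<longleftrightarrow> (\<exists>F. finite F \<and> F \<subseteq> E \<and>
    (\<forall>G. finite G \<and> F \<subseteq> G \<and> G \<subseteq> E \<longrightarrow> Q G x))" for x
  have Qadd: "Q G (x + y)" if "Q G x" "Q G y" for G x y
  proof -
    have "x + y = (\<Sum>e\<in>G. cinner e x *\<^sub>C e) + (\<Sum>e\<in>G. cinner e y *\<^sub>C e)"
      by (rule arg_cong2[where f = "(+)", OF that[unfolded Q_def]])
    also have "\<dots> = (\<Sum>e\<in>G. cinner e (x + y) *\<^sub>C e)"
      by (simp add: cinner_add_right scaleC_add_left sum.distrib)
    finally show ?thesis unfolding Q_def .
  qed
  have Qscale: "Q G (c *\<^sub>C x)" if "Q G x" for G c x
  proof -
    have "c *\<^sub>C x = c *\<^sub>C (\<Sum>e\<in>G. cinner e x *\<^sub>C e)"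
      by (rule arg_cong[where f = "(*\<^sub>C) c", OF that[unfolded Q_def]])
    also have "\<dots> = (\<Sum>e\<in>G. cinner e (c *\<^sub>C x) *\<^sub>C e)"
      by (simp add: scaleC_sum_right scaleC_scaleC cinner_scaleC_right)
    finally show ?thesis unfolding Q_def .
  qed
  have Qbase: "Q G e" if "finite G" "e \<in> G" "G \<subseteq> E" for G e
  proof -
    have "(\<Sum>f\<in>G. cinner f e *\<^sub>C f) = (\<Sum>f\<in>G. if f = e then e else 0)"
      using that E by (intro sum.cong) (auto simp: orthonormal_def subset_iff)
    also have "\<dots> = e" using that by simp
    finally show ?thesis unfolding Q_def by (rule sym)
  qed
  have add: "P (x + y)" if "P x" "P y" for x y
  proof -
    obtain F where F: "finite F" "F \<subseteq> E"
      "\<forall>G. finite G \<and> F \<subseteq> G \<and> G \<subseteq> E \<longrightarrow> Q G x"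
      using \<open>P x\<close> unfolding P_def by (elim exE conjE)
    obtain F' where F': "finite F'" "F' \<subseteq> E"
      "\<forall>G. finite G \<and> F' \<subseteq> G \<and> G \<subseteq> E \<longrightarrow> Q G y"
      using \<open>P y\<close> unfolding P_def by (elim exE conjE)
    show ?thesis unfolding P_def
    proof (intro exI[of _ "F \<union> F'"] conjI allI impI)
      fix G assume "finite G \<and> F \<union> F' \<subseteq> G \<and> G \<subseteq> E"
      thus "Q G (x + y)" using F(3) F'(3) by (simp add: Qadd)
    qed (use F(1,2) F'(1,2) in simp_all)
  qed
  have scale: "P (c *\<^sub>C x)" if "P x" for c x
  proof -
    obtain F where F: "finite F" "F \<subseteq> E"
      "\<forall>G. finite G \<and> F \<subseteq> G \<and> G \<subseteq> E \<longrightarrow> Q G x"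
      using \<open>P x\<close> unfolding P_def by (elim exE conjE)
    show ?thesis unfolding P_def
      using F Qscale by (intro exI[of _ F]) simp
  qed
  have base: "P e" if e: "e \<in> E" for e
    unfolding P_def using e by (intro exI[of _ "{e}"]) (auto intro: Qbase)
  have "P x" using x unfolding cspan_def
  proof (induction rule: span_induct_alt)
    case base
    show ?case unfolding P_def Q_def by (intro exI[of _ "{}"]) auto
  next
    case (step a x y)
    then obtain c e where x: "x = c *\<^sub>C e" "e \<in> E" by blast
    show ?case unfolding x(1) scaleR_scaleC
      by (rule add[OF scale[OF scale[OF base[OF x(2)]]] step(2)])
  qed
  then obtain F where "finite F" "F \<subseteq> E" "Q F x" unfolding P_def by auto
  thus ?thesis unfolding Q_def by (intro exI conjI)
qed

lemma hilbert_schmidt_norm_bound: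
  fixes T :: "'a::chilbert_space \<Rightarrow> 'a"
  assumes T: "hilbert_schmidt T"
  shows "norm (T x) \<le> sqrt (\<Sum>\<^sub>\<infinity>e\<in>some_onb. (norm (T e))\<^sup>2) * norm x"
proof -
  let ?E = "some_onb :: 'a set"
  let ?C = "sqrt (\<Sum>\<^sub>\<infinity>e\<in>?E. (norm (T e))\<^sup>2)"
  have E: "orthonormal ?E" "closure (cspan ?E) = UNIV"
    using orthonormal_basis_some_onb unfolding orthonormal_basis_def by auto
  have bl: "bounded_linear T" and cl: "\<And>c x. T (c *\<^sub>C x) = c *\<^sub>C T x"
    and su: "(\<lambda>e. (norm (T e))\<^sup>2) summable_on ?E"
    using T unfolding hilbert_schmidt_def bounded_clinear_def by auto
  have "cspan ?E \<subseteq> {x. norm (T x) \<le> ?C * norm x}"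
  proof
    fix x assume "x \<in> cspan ?E"
    then obtain F where F: "finite F" "F \<subseteq> ?E" and x: "x = (\<Sum>e\<in>F. cinner e x *\<^sub>C e)"
      using cspan_expansion[OF E(1)] by blast
    have "complex_of_real ((norm x)\<^sup>2) = cinner x (\<Sum>e\<in>F. cinner e x *\<^sub>C e)"
      unfolding x[symmetric] cinner_self ..
    also have "\<dots> = (\<Sum>e\<in>F. cinner e x * cnj (cinner e x))"
      by (simp add: cinner_sum_right cinner_scaleC_right flip: cinner_commute)
    also have "\<dots> = complex_of_real (\<Sum>e\<in>F. (cmod (cinner e x))\<^sup>2)"
      unfolding of_real_sum by (intro sum.cong refl complex_norm_square[symmetric])
    finally have nx: "(\<Sum>e\<in>F. (cmod (cinner e x))\<^sup>2) = (norm x)\<^sup>2"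
      by (metis of_real_eq_iff)
    have "T x = T (\<Sum>e\<in>F. cinner e x *\<^sub>C e)" by (rule arg_cong[where f = T, OF x])
    also have "\<dots> = (\<Sum>e\<in>F. cinner e x *\<^sub>C T e)"
      by (simp add: linear_sum[OF bounded_linear.linear[OF bl]] cl)
    finally have "norm (T x) \<le> (\<Sum>e\<in>F. \<bar>cmod (cinner e x)\<bar> * \<bar>norm (T e)\<bar>)"
      by (simp add: sum_norm_le norm_scaleC)
    also have "\<dots> \<le> L2_set (\<lambda>e. cmod (cinner e x)) F * L2_set (\<lambda>e. norm (T e)) F"
      by (rule L2_set_mult_ineq)
    also have "L2_set (\<lambda>e. cmod (cinner e x)) F = norm x"
      by (simp add: L2_set_def nx)
    also have "norm x * L2_set (\<lambda>e. norm (T e)) F \<le> norm x * ?C"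
      unfolding L2_set_def using F su
      by (intro mult_left_mono real_sqrt_le_mono finite_sum_le_infsum) auto
    finally show "x \<in> {x. norm (T x) \<le> ?C * norm x}" by (simp add: mult.commute)
  qed
  moreover have "closed {x. norm (T x) \<le> ?C * norm x}"
    by (intro closed_Collect_le continuous_intros
        linear_continuous_on bl)
  ultimately have "closure (cspan ?E) \<subseteq> {x. norm (T x) \<le> ?C * norm x}"
    by (rule closure_minimal)
  thus ?thesis using E(2) by auto
qed

lemma hilbert_schmidt_zero: "hilbert_schmidt (\<lambda>x. 0)"
  unfolding hilbert_schmidt_def bounded_clinear_def by (auto intro: bounded_linear_zero)

lemma hilbert_schmidt_add:
  fixes A B :: "'a::chilbert_space \<Rightarrow> 'a"
  assumes "hilbert_schmidt A" "hilbert_schmidt B"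
  shows "hilbert_schmidt (\<lambda>x. A x + B x)"
  unfolding hilbert_schmidt_def
proof
  show "bounded_clinear (\<lambda>x. A x + B x)"
    using assms unfolding hilbert_schmidt_def bounded_clinear_def
    by (auto intro: bounded_linear_add simp: scaleC_add_right)
  have "(\<lambda>e. 2 * (norm (A e))\<^sup>2 + 2 * (norm (B e))\<^sup>2) summable_on some_onb"
    using assms unfolding hilbert_schmidt_def
    by (intro summable_on_add summable_on_cmult_right) auto
  moreover have "(norm (A e + B e))\<^sup>2 \<le> 2 * (norm (A e))\<^sup>2 + 2 * (norm (B e))\<^sup>2" for e
  proof -
    have "(norm (A e + B e))\<^sup>2 \<le> (norm (A e) + norm (B e))\<^sup>2"
      by (intro power_mono norm_triangle_ineq) auto
    also have "\<dots> \<le> 2 * (norm (A e))\<^sup>2 + 2 * (norm (B e))\<^sup>2"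
      using sum_squares_bound[of "norm (A e)" "norm (B e)"] by (simp add: power2_sum)
    finally show ?thesis .
  qed
  ultimately show "(\<lambda>e. (norm (A e + B e))\<^sup>2) summable_on (some_onb :: 'a set)"
    by (rule summable_on_comparison_test[OF _ _ zero_le_power2])
qed

lemma hilbert_schmidt_scaleC:
  assumes "hilbert_schmidt A"
  shows "hilbert_schmidt (\<lambda>x. c *\<^sub>C A x)"
  unfolding hilbert_schmidt_def
proof
  have "bounded_linear (\<lambda>x::'a. c *\<^sub>C x)"
    by (rule bounded_linear_intro[where K = "cmod c"])
      (auto simp: scaleC_add_right norm_scaleC scaleR_scaleC scaleC_scaleC mult.commute)
  thus "bounded_clinear (\<lambda>x. c *\<^sub>C A x)"
    using assms unfolding hilbert_schmidt_def bounded_clinear_def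
    by (auto intro: bounded_linear_compose simp: scaleC_scaleC mult.commute)
  show "(\<lambda>e. (norm (c *\<^sub>C A e))\<^sup>2) summable_on some_onb"
    using assms unfolding hilbert_schmidt_def
    by (auto simp: norm_scaleC power_mult_distrib intro: summable_on_cmult_right)
qed

lemma hilbert_schmidt_summable_cinner:
  assumes "hilbert_schmidt A" "hilbert_schmidt B"
  shows "(\<lambda>e. cinner (A e) (B e)) summable_on some_onb"
proof (rule abs_summable_summable, rule summable_on_comparison_test)
  show "(\<lambda>e. (norm (A e))\<^sup>2 + (norm (B e))\<^sup>2) summable_on some_onb"
    using assms unfolding hilbert_schmidt_def by (intro summable_on_add) auto
  show "cmod (cinner (A e) (B e)) \<le> (norm (A e))\<^sup>2 + (norm (B e))\<^sup>2" for e
  proof -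
    have "cmod (cinner (A e) (B e)) \<le> norm (A e) * norm (B e)"
      by (rule norm_cinner_le)
    also have "\<dots> \<le> (norm (A e))\<^sup>2 + (norm (B e))\<^sup>2"
      using sum_squares_bound[of "norm (A e)" "norm (B e)"]
        mult_nonneg_nonneg[OF norm_ge_zero[of "A e"] norm_ge_zero[of "B e"]] by linarith
    finally show ?thesis .
  qed
qed auto

lemma Re_infsum_cinner_self:
  assumes "hilbert_schmidt A"
  shows "Re (\<Sum>\<^sub>\<infinity>e\<in>some_onb. cinner (A e) (A e)) = (\<Sum>\<^sub>\<infinity>e\<in>some_onb. (norm (A e))\<^sup>2)"
  using infsum_Re[OF hilbert_schmidt_summable_cinner[OF assms assms]] by (simp add: cinner_self)

typedef (overloaded) 'a hs_op = "{T::'a::chilbert_space \<Rightarrow> 'a. hilbert_schmidt T}"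
  morphisms hs_apply Abs_hs_op
  using hilbert_schmidt_zero by blast

setup_lifting type_definition_hs_op

instantiation hs_op :: (chilbert_space) real_vector
begin

lift_definition zero_hs_op :: "'a hs_op" is "\<lambda>x. 0"
  by (rule hilbert_schmidt_zero)

lift_definition plus_hs_op :: "'a hs_op \<Rightarrow> 'a hs_op \<Rightarrow> 'a hs_op" is "\<lambda>A B x. A x + B x"
  by (rule hilbert_schmidt_add)

lift_definition scaleR_hs_op :: "real \<Rightarrow> 'a hs_op \<Rightarrow> 'a hs_op" is "\<lambda>r A x. r *\<^sub>R A x"
  unfolding scaleR_scaleC by (rule hilbert_schmidt_scaleC)

definition uminus_hs_op :: "'a hs_op \<Rightarrow> 'a hs_op" where
  "uminus_hs_op A = (-1) *\<^sub>R A"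

definition minus_hs_op :: "'a hs_op \<Rightarrow> 'a hs_op \<Rightarrow> 'a hs_op" where
  "minus_hs_op A B = A + - B"

instance
proof
  fix A B C :: "'a hs_op" and r s :: real
  show "A + B + C = A + (B + C)" by transfer (simp add: add.assoc)
  show "A + B = B + A" by transfer (simp add: add.commute)
  show "0 + A = A" by transfer simp
  show "- A + A = 0" unfolding uminus_hs_op_def by transfer simp
  show "A - B = A + - B" by (rule minus_hs_op_def)
  show "r *\<^sub>R (A + B) = r *\<^sub>R A + r *\<^sub>R B" by transfer (simp add: scaleR_add_right)
  show "(r + s) *\<^sub>R A = r *\<^sub>R A + s *\<^sub>R A" by transfer (simp add: scaleR_add_left)
  show "r *\<^sub>R s *\<^sub>R A = (r * s) *\<^sub>R A" by transfer simp
  show "1 *\<^sub>R A = A" by transfer simp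
qed

end

instantiation hs_op :: (chilbert_space) complex_inner
begin

lift_definition scaleC_hs_op :: "complex \<Rightarrow> 'a hs_op \<Rightarrow> 'a hs_op" is "\<lambda>c A x. c *\<^sub>C A x"
  by (rule hilbert_schmidt_scaleC)

lift_definition cinner_hs_op :: "'a hs_op \<Rightarrow> 'a hs_op \<Rightarrow> complex" is
  "\<lambda>A B. \<Sum>\<^sub>\<infinity>e\<in>some_onb. cinner (A e) (B e)" .

definition inner_hs_op :: "'a hs_op \<Rightarrow> 'a hs_op \<Rightarrow> real" where
  "inner_hs_op A B = Re (cinner A B)"

definition norm_hs_op :: "'a hs_op \<Rightarrow> real" where
  "norm_hs_op A = sqrt (inner A A)"

definition sgn_hs_op :: "'a hs_op \<Rightarrow> 'a hs_op" where
  "sgn_hs_op A = inverse (norm A) *\<^sub>R A"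

definition dist_hs_op :: "'a hs_op \<Rightarrow> 'a hs_op \<Rightarrow> real" where
  "dist_hs_op A B = norm (A - B)"

definition uniformity_hs_op :: "('a hs_op \<times> 'a hs_op) filter" where
  "uniformity_hs_op = (INF e\<in>{0<..}. principal {(x, y). dist x y < e})"

definition open_hs_op :: "'a hs_op set \<Rightarrow> bool" where
  "open_hs_op U \<longleftrightarrow> (\<forall>x\<in>U. eventually (\<lambda>(x', y). x' = x \<longrightarrow> y \<in> U) uniformity)"

instance
proof
  fix A B C :: "'a hs_op" and c d :: complex and r :: real
  show "sgn A = A /\<^sub>R norm A" by (rule sgn_hs_op_def)
  show "dist A B = norm (A - B)" by (rule dist_hs_op_def)
  show "uniformity = (INF e\<in>{0<..}. principal {(x, y::'a hs_op). dist x y < e})"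
    by (rule uniformity_hs_op_def)
  show "open U \<longleftrightarrow> (\<forall>x\<in>U. eventually (\<lambda>(x', y). x' = x \<longrightarrow> y \<in> U) uniformity)"
    for U :: "'a hs_op set"
    by (rule open_hs_op_def)
  show "r *\<^sub>R A = complex_of_real r *\<^sub>C A" by transfer (simp add: scaleR_scaleC)
  show "c *\<^sub>C (A + B) = c *\<^sub>C A + c *\<^sub>C B" by transfer (simp add: scaleC_add_right)
  show "(c + d) *\<^sub>C A = c *\<^sub>C A + d *\<^sub>C A" by transfer (simp add: scaleC_add_left)
  show "c *\<^sub>C d *\<^sub>C A = (c * d) *\<^sub>C A" by transfer (simp add: scaleC_scaleC)
  show cinC: "cinner A B = cnj (cinner B A)" for A B :: "'a hs_op"
    by transfer (simp flip: infsum_cnj cinner_commute)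
  show cinA: "cinner (A + B) C = cinner A C + cinner B C"
    by transfer (simp add: cinner_add_left infsum_add hilbert_schmidt_summable_cinner)
  show "cinner (c *\<^sub>C A) B = cnj c * cinner A B"
    by transfer (simp add: cinner_scaleC_left infsum_cmult_right')
  show "inner A B = Re (cinner A B)" by (rule inner_hs_op_def)
  show "inner A B = inner B A" by (metis inner_hs_op_def cinC cnj.simps(1))
  show "inner (A + B) C = inner A C + inner B C" by (simp add: inner_hs_op_def cinA)
  show "inner (r *\<^sub>R A) B = r * inner A B"
    unfolding inner_hs_op_def
    by transfer (simp add: scaleR_scaleC cinner_scaleC_left infsum_cmult_right')
  have self: "inner A A = (\<Sum>\<^sub>\<infinity>e\<in>some_onb. (norm (hs_apply A e))\<^sup>2)"
    unfolding inner_hs_op_def cinner_hs_op.rep_eq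
    by (rule Re_infsum_cinner_self) (use hs_apply in blast)
  show "0 \<le> inner A A" unfolding self by (rule infsum_nonneg) simp
  show "inner A A = 0 \<longleftrightarrow> A = 0"
  proof
    assume "inner A A = 0"
    hence "norm (hs_apply A x) \<le> 0" for x
      using hilbert_schmidt_norm_bound[of "hs_apply A" x] hs_apply[of A] by (simp add: self)
    thus "A = 0" by (intro hs_apply_inject[THEN iffD1] ext) (simp add: zero_hs_op.rep_eq)
  next
    assume "A = 0"
    thus "inner A A = 0" unfolding self by (simp add: zero_hs_op.rep_eq)
  qed
  show "norm A = sqrt (inner A A)" by (rule norm_hs_op_def)
qed

end

lemma hilbert_schmidt_hs_apply: "hilbert_schmidt (hs_apply A)"
  using hs_apply by blast

lemma norm_hs_op_power2: "(norm A)\<^sup>2 = (\<Sum>\<^sub>\<infinity>e\<in>some_onb. (norm (hs_apply A e))\<^sup>2)"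
proof -
  have "(norm A)\<^sup>2 = Re (cinner A A)" by (simp add: cinner_self)
  thus ?thesis
    by (simp only: cinner_hs_op.rep_eq Re_infsum_cinner_self[OF hilbert_schmidt_hs_apply])
qed

lemma hs_apply_diff: "hs_apply (A - B) x = hs_apply A x - hs_apply B x"
proof -
  have "hs_apply A x = hs_apply ((A - B) + B) x" by simp
  also have "\<dots> = hs_apply (A - B) x + hs_apply B x" by (simp only: plus_hs_op.rep_eq)
  finally show ?thesis by (rule eq_diff_eq[THEN iffD2, OF sym])
qed

lemma norm_hs_apply_le: "norm (hs_apply A x) \<le> norm A * norm x"
  using hilbert_schmidt_norm_bound[OF hilbert_schmidt_hs_apply, of A x]
  by (simp flip: norm_hs_op_power2)

lemma sum_hs_apply_le:
  assumes "finite F" "F \<subseteq> some_onb"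
  shows "(\<Sum>e\<in>F. (norm (hs_apply A e))\<^sup>2) \<le> (norm A)\<^sup>2"
  unfolding norm_hs_op_power2
  using hilbert_schmidt_hs_apply[of A] assms unfolding hilbert_schmidt_def
  by (intro finite_sum_le_infsum) auto

instance hs_op :: (chilbert_space) chilbert_space
proof
  fix X :: "nat \<Rightarrow> 'a hs_op"
  assume X: "Cauchy X"
  have bl: "bounded_linear (hs_apply A)" and cl: "hs_apply A (c *\<^sub>C x) = c *\<^sub>C hs_apply A x"
    for A :: "'a hs_op" and c x
    using hilbert_schmidt_hs_apply[of A] unfolding hilbert_schmidt_def bounded_clinear_def by auto
  have "Cauchy (\<lambda>n. hs_apply (X n) x)" for x
  proof (rule metric_CauchyI)
    fix e :: real assume e: "0 < e"
    have "0 < e / (norm x + 1)" using e by (simp add: add_nonneg_pos)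
    then obtain N where N: "\<And>m n. m \<ge> N \<Longrightarrow> n \<ge> N \<Longrightarrow> dist (X m) (X n) < e / (norm x + 1)"
      using metric_CauchyD[OF X] by meson
    show "\<exists>N. \<forall>m\<ge>N. \<forall>n\<ge>N. dist (hs_apply (X m) x) (hs_apply (X n) x) < e"
    proof (intro exI allI impI)
      fix m n assume mn: "N \<le> m" "N \<le> n"
      have "dist (hs_apply (X m) x) (hs_apply (X n) x) \<le> norm (X m - X n) * norm x"
        using norm_hs_apply_le[of "X m - X n" x] by (simp add: dist_norm hs_apply_diff)
      also have "\<dots> \<le> norm (X m - X n) * (norm x + 1)" by (rule mult_left_mono) auto
      also have "\<dots> < e"
        using N[OF mn] by (simp add: dist_norm pos_less_divide_eq add_nonneg_pos)
      finally show "dist (hs_apply (X m) x) (hs_apply (X n) x) < e" .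
    qed
  qed
  hence "\<exists>l. (\<lambda>n. hs_apply (X n) x) \<longlonglongrightarrow> l" for x
    by (simp add: Cauchy_convergent_iff convergent_def)
  then obtain T where T: "\<And>x. (\<lambda>n. hs_apply (X n) x) \<longlonglongrightarrow> T x" by metis
  obtain M where M: "\<And>n. norm (X n) \<le> M"
    using Cauchy_Bseq[OF X] unfolding Bseq_def by blast
  have M0: "0 \<le> M" using M[of 0] norm_ge_zero order_trans by blast
  have add: "T (x + y) = T x + T y" for x y
  proof (rule LIMSEQ_unique[OF T])
    show "(\<lambda>n. hs_apply (X n) (x + y)) \<longlonglongrightarrow> T x + T y"
      using tendsto_add[OF T[of x] T[of y]] by (simp add: linear_add[OF bounded_linear.linear[OF bl]])
  qed
  have scale: "T (c *\<^sub>C x) = c *\<^sub>C T x" for c x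
  proof (rule LIMSEQ_unique[OF T])
    show "(\<lambda>n. hs_apply (X n) (c *\<^sub>C x)) \<longlonglongrightarrow> c *\<^sub>C T x"
      using tendsto_scaleC[OF T[of x]] by (simp add: cl)
  qed
  have "norm (T x) \<le> norm x * M" for x
  proof (rule LIMSEQ_le_const2[OF tendsto_norm[OF T]], intro exI allI impI)
    fix n
    have "norm (hs_apply (X n) x) \<le> norm (X n) * norm x" by (rule norm_hs_apply_le)
    also have "\<dots> \<le> M * norm x" by (intro mult_right_mono M) auto
    finally show "norm (hs_apply (X n) x) \<le> norm x * M" by (simp add: mult.commute)
  qed
  hence "bounded_linear T"
    by (intro bounded_linear_intro[where K = M]) (auto simp: add scaleR_scaleC scale)
  hence Tc: "bounded_clinear T" by (simp add: bounded_clinear_def scale)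
  have sumT: "(\<Sum>e\<in>F. (norm (hs_apply A e - T e))\<^sup>2) \<le> r\<^sup>2"
    if F: "finite F" "F \<subseteq> some_onb" and N: "\<And>m. m \<ge> N \<Longrightarrow> norm (A - X m) \<le> r" for A F N r
  proof (rule LIMSEQ_le_const2)
    show "(\<lambda>m. \<Sum>e\<in>F. (norm (hs_apply A e - hs_apply (X m) e))\<^sup>2)
        \<longlonglongrightarrow> (\<Sum>e\<in>F. (norm (hs_apply A e - T e))\<^sup>2)"
      by (intro tendsto_intros T)
    have "(\<Sum>e\<in>F. (norm (hs_apply A e - hs_apply (X m) e))\<^sup>2) \<le> r\<^sup>2" if "m \<ge> N" for m
    proof -
      have "(\<Sum>e\<in>F. (norm (hs_apply A e - hs_apply (X m) e))\<^sup>2) \<le> (norm (A - X m))\<^sup>2"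
        using sum_hs_apply_le[OF F, of "A - X m"] by (simp add: hs_apply_diff)
      also have "\<dots> \<le> r\<^sup>2" using N[OF that] by (intro power_mono) auto
      finally show ?thesis .
    qed
    thus "\<exists>N. \<forall>m\<ge>N. (\<Sum>e\<in>F. (norm (hs_apply A e - hs_apply (X m) e))\<^sup>2) \<le> r\<^sup>2" by blast
  qed
  have "(\<lambda>e. (norm (T e))\<^sup>2) summable_on some_onb"
  proof (rule nonneg_bdd_above_summable_on)
    have "(\<Sum>e\<in>F. (norm (T e))\<^sup>2) \<le> M\<^sup>2" if "finite F" "F \<subseteq> some_onb" for F
      using sumT[OF that, of 0 0 M] M by (simp add: zero_hs_op.rep_eq)
    thus "bdd_above (sum (\<lambda>e. (norm (T e))\<^sup>2) ` {F. F \<subseteq> some_onb \<and> finite F})"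
      by (auto simp: bdd_above_def)
  qed auto
  hence HS: "hilbert_schmidt T" using Tc by (simp add: hilbert_schmidt_def)
  define L where "L = Abs_hs_op T"
  have L: "hs_apply L = T" using HS by (simp add: L_def Abs_hs_op_inverse)
  have "X \<longlonglongrightarrow> L"
  proof (rule metric_LIMSEQ_I)
    fix e :: real assume e: "0 < e"
    then obtain N where N: "\<And>m n. m \<ge> N \<Longrightarrow> n \<ge> N \<Longrightarrow> dist (X m) (X n) < e / 2"
      using metric_CauchyD[OF X, of "e / 2"] by auto
    show "\<exists>N. \<forall>n\<ge>N. dist (X n) L < e"
    proof (intro exI allI impI)
      fix n assume n: "N \<le> n"
      have "(norm (X n - L))\<^sup>2 \<le> (e / 2)\<^sup>2"
        unfolding norm_hs_op_power2
      proof (rule infsum_le_finite_sums)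
        show "(\<lambda>f. (norm (hs_apply (X n - L) f))\<^sup>2) summable_on some_onb"
          using hilbert_schmidt_hs_apply[of "X n - L"] by (simp add: hilbert_schmidt_def)
        fix F :: "'a set" assume F: "finite F" "F \<subseteq> some_onb"
        have "norm (X n - X m) \<le> e / 2" if "m \<ge> N" for m
          using N[OF n that] by (simp add: dist_norm)
        from sumT[OF F this]
        show "(\<Sum>f\<in>F. (norm (hs_apply (X n - L) f))\<^sup>2) \<le> (e / 2)\<^sup>2"
          by (simp only: hs_apply_diff L)
      qed
      hence "norm (X n - L) \<le> e / 2" by (rule power2_le_imp_le) (use e in simp)
      thus "dist (X n) L < e" using e by (simp add: dist_norm)
    qed
  qed
  thus "convergent X" by (auto simp: convergent_def)
qed

text \<open>
  Maps \<open>F\<close> on operators are total functions; the restriction to the Hilbert-Schmidt operators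
  is meaningful when \<open>preserves_hilbert_schmidt F\<close> holds.
\<close>

definition preserves_hilbert_schmidt ::
    "(('a::chilbert_space \<Rightarrow> 'a) \<Rightarrow> ('a \<Rightarrow> 'a)) \<Rightarrow> bool" where
  "preserves_hilbert_schmidt F \<longleftrightarrow> (\<forall>T. hilbert_schmidt T \<longrightarrow> hilbert_schmidt (F T))"

definition hs_restrict ::
    "(('a::chilbert_space \<Rightarrow> 'a) \<Rightarrow> ('a \<Rightarrow> 'a)) \<Rightarrow> 'a hs_op \<Rightarrow> 'a hs_op" where
  "hs_restrict F A = Abs_hs_op (F (hs_apply A))"

section \<open>Tensor products and crossing\<close>

text \<open>
  \<open>tens\<close> exhibits \<open>'b\<close> as the Hilbert space tensor product of \<open>'a\<close> with itself; this determines
  \<open>('b, tens)\<close> up to a unique unitary. The real span suffices because the set of simple tensors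
  is invariant under complex scalars.
\<close>

definition hilbert_tensor ::
    "('a::complex_inner \<Rightarrow> 'a \<Rightarrow> 'b::complex_inner) \<Rightarrow> bool" where
  "hilbert_tensor tens \<longleftrightarrow>
    (\<forall>x x' y. tens (x + x') y = tens x y + tens x' y) \<and>
    (\<forall>x y y'. tens x (y + y') = tens x y + tens x y') \<and>
    (\<forall>c x y. tens (c *\<^sub>C x) y = c *\<^sub>C tens x y) \<and>
    (\<forall>c x y. tens x (c *\<^sub>C y) = c *\<^sub>C tens x y) \<and>
    (\<forall>x y x' y'. cinner (tens x y) (tens x' y') = cinner x x' * cinner y y') \<and>
    closure (span {tens x y |x y. True}) = UNIV"

definition tensor_op ::
    "('a::complex_inner \<Rightarrow> 'a \<Rightarrow> 'b::complex_inner) \<Rightarrow> ('a \<Rightarrow> 'a) \<Rightarrow> ('a \<Rightarrow> 'a) \<Rightarrow> 'b \<Rightarrow> 'b" where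
  "tensor_op tens A B =
    (THE R. bounded_clinear R \<and> (\<forall>x y. R (tens x y) = tens (A x) (B y)))"

definition is_crossing ::
    "('a::complex_inner \<Rightarrow> 'a \<Rightarrow> 'b::complex_inner) \<Rightarrow> ('a \<Rightarrow> 'a) \<Rightarrow> ('b \<Rightarrow> 'b) \<Rightarrow> ('b \<Rightarrow> 'b) \<Rightarrow> bool" where
  "is_crossing tens S T R \<longleftrightarrow> bounded_clinear R \<and>
    (\<forall>\<phi>\<^sub>1 \<phi>\<^sub>2 \<psi>\<^sub>1 \<psi>\<^sub>2.
      cinner (tens \<phi>\<^sub>2 (antilinear_adjoint S \<psi>\<^sub>2)) (T (tens (S \<phi>\<^sub>1) \<psi>\<^sub>1)) =
      cinner (tens \<phi>\<^sub>1 \<phi>\<^sub>2) (R (tens \<psi>\<^sub>1 \<psi>\<^sub>2)))"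

definition crossable ::
    "('a::complex_inner \<Rightarrow> 'a \<Rightarrow> 'b::complex_inner) \<Rightarrow> ('a \<Rightarrow> 'a) \<Rightarrow> ('b \<Rightarrow> 'b) \<Rightarrow> bool" where
  "crossable tens S T \<longleftrightarrow> bounded_clinear T \<and> (\<exists>!R. is_crossing tens S T R)"

definition crossing ::
    "('a::complex_inner \<Rightarrow> 'a \<Rightarrow> 'b::complex_inner) \<Rightarrow> ('a \<Rightarrow> 'a) \<Rightarrow> ('b \<Rightarrow> 'b) \<Rightarrow> 'b \<Rightarrow> 'b" where
  "crossing tens S T = (THE R. is_crossing tens S T R)"

text \<open>
  Crossability does not depend on the bounded antilinear involution, so the common set of
  crossable operators is also the intersection over all involutions.
\<close>

definition crossable_ops :: "('a::complex_inner \<Rightarrow> 'a \<Rightarrow> 'b::complex_inner) \<Rightarrow> ('b \<Rightarrow> 'b) set" where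
  "crossable_ops tens = {T. \<forall>S. bounded_antilinear_involution S \<longrightarrow> crossable tens S T}"

text \<open>\<open>hat tens S\<close> and \<open>hat tens J\<close> are the operators written \<open>S\<close>-hat and \<open>J\<close>-hat.\<close>

definition hat ::
    "('a::complex_inner \<Rightarrow> 'a \<Rightarrow> 'b::complex_inner) \<Rightarrow> ('a \<Rightarrow> 'a) \<Rightarrow> ('b \<Rightarrow> 'b) \<Rightarrow> 'b \<Rightarrow> 'b" where
  "hat tens S T = cadjoint (crossing tens S T)"

text \<open>The map \<open>T \<mapsto> (1 \<otimes> \<Delta>\<^sup>\<alpha>) T (\<Delta>\<^sup>-\<^sup>\<alpha> \<otimes> 1)\<close> for \<open>\<alpha> = 1/2\<close>.\<close>

definition hat_Delta_half ::
    "('a::complex_inner \<Rightarrow> 'a \<Rightarrow> 'b::complex_inner) \<Rightarrow> ('a \<Rightarrow> 'a) \<Rightarrow> ('b \<Rightarrow> 'b) \<Rightarrow> 'b \<Rightarrow> 'b" where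
  "hat_Delta_half tens \<Delta> T =
    tensor_op tens id (op_sqrt \<Delta>) \<circ> T \<circ> tensor_op tens (inv (op_sqrt \<Delta>)) id"

definition hat_H ::
    "('a::complex_inner \<Rightarrow> 'a \<Rightarrow> 'b::complex_inner) \<Rightarrow> ('a \<Rightarrow> 'a) \<Rightarrow> ('b \<Rightarrow> 'b) set" where
  "hat_H tens S = {T \<in> crossable_ops tens. hat tens S T = T}"

end

theory Submission
  imports Defs
begin

text \<open>
  The scalar product of \<open>|u\<rangle>\<langle>v|\<close> with a Hilbert-Schmidt operator \<open>A\<close> is \<open>\<langle>u, A v\<rangle>\<close>, so the matrix
  elements defining a crossing are scalar products with rank one operators, and
  \<open>Cr\<^sub>J\<close> is the adjoint of an isometry permuting these. With \<open>J = J\<^sup>-\<^sup>1\<close>, any other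
  involution \<open>S\<close> is reduced to \<open>J\<close> by \<open>Cr\<^sub>S(T) = Cr\<^sub>J((1 \<otimes> J S) T (S J \<otimes> 1))\<close>; for the \<open>S\<close> with
  polar decomposition \<open>J \<Delta>\<^sup>1\<^sup>/\<^sup>2\<close> the inner operation is the positive operator given by
  left multiplication with \<open>1 \<otimes> \<Delta>\<^sup>1\<^sup>/\<^sup>2\<close> and right multiplication with \<open>\<Delta>\<^sup>-\<^sup>1\<^sup>/\<^sup>2 \<otimes> 1\<close>, which
  commute. Since \<open>Cr\<^sub>S(Cr\<^sub>S(T)\<^sup>*) = T\<^sup>*\<close>, the map \<open>T \<mapsto> Cr\<^sub>S(T)\<^sup>*\<close> is a bounded antilinear involution;
  hence \<open>Cr\<^sub>S\<close> is bijective, and the fixed points form a standard subspace.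
\<close>

section \<open>Complex inner product spaces\<close>

text \<open>The square root \<open>op_sqrt \<Delta>\<close> enters only through the given polar
  decomposition, which supplies a positive factor and an antilinear partial isometry with the same
  kernel. That this isometry is norm preserving and involutive, and that the positive factor has the
  inverse \<open>S \<circ> J\<close>, must be extracted from the fact that \<open>S\<close> squares
  to the identity.

  The tensor product is abstract and known only through simple tensors, on whose sums a formula for
  an operator need not be well defined. Operators are therefore presented by graphs spanned by pairs
  of vectors; one norm estimate on the graph yields both single-valuedness and the bounded
  extension.

  Unitarity of the crossing map for \<open>J\<close> also rests on one estimate: the map is a
  contraction, followed by the adjoint it squares to the identity, and a contractive involution is
  isometric. Surjectivity comes with the involution, so the range of the isometry on rank one
  operators is never computed.\<close>

lemma cinner_diff_right: "cinner x (y - z) = cinner x y - cinner (x::'a::complex_inner) z"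
  using cinner_add_right[of x "y - z" z] by simp

lemma cinner_sum_left:
  "cinner (\<Sum>i\<in>I. f i) y = (\<Sum>i\<in>I. cinner (f i :: 'a::complex_inner) y)"
  by (induction I rule: infinite_finite_induct) (auto simp: cinner_add_left)

lemma cinner_ext_right:
  fixes x y :: "'a::complex_inner"
  assumes "\<And>v. cinner v x = cinner v y"
  shows "x = y"
proof -
  have "cinner (x - y) (x - y) = 0"
    using assms[of "x - y"] by (simp add: cinner_diff_right)
  thus ?thesis by (simp add: cinner_self)
qed

lemma cinner_ext_left:
  fixes x y :: "'a::complex_inner"
  assumes "\<And>v. cinner x v = cinner y v"
  shows "x = y"
  by (rule cinner_ext_right) (metis assms cinner_commute)

lemma Im_cinner: "Im (cinner x y) = inner (\<i> *\<^sub>C x) (y::'a::complex_inner)"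
  by (simp add: inner_cinner cinner_scaleC_left)

lemma bounded_linear_cinner_right: "bounded_linear (cinner (x::'a::complex_inner))"
  by (rule bounded_linear_intro[where K = "norm x"])
    (auto simp: cinner_add_right scaleR_scaleC cinner_scaleC_right scaleR_conv_of_real
      norm_cinner_le mult.commute[of _ "norm x"])

lemma bounded_linear_scaleC_right: "bounded_linear (\<lambda>x::'a::complex_inner. c *\<^sub>C x)"
  by (rule bounded_linear_intro[where K = "cmod c"])
    (auto simp: scaleC_add_right norm_scaleC scaleR_scaleC scaleC_scaleC mult.commute)

lemma bounded_linear_scaleC_left: "bounded_linear (\<lambda>c. c *\<^sub>C (x::'a::complex_inner))"
  by (rule bounded_linear_intro[where K = "norm x"])
    (auto simp: scaleC_add_left norm_scaleC scaleR_scaleC scaleC_scaleC scaleR_conv_of_real)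

lemma scaleC_diff_left: "(c - d) *\<^sub>C x = c *\<^sub>C x - d *\<^sub>C (x::'a::complex_inner)"
  by (rule linear_diff[OF bounded_linear.linear[OF bounded_linear_scaleC_left]])

lemma scaleC_minus_left: "(- c) *\<^sub>C x = - (c *\<^sub>C (x::'a::complex_inner))"
  using scaleC_diff_left[of 0 c x] by simp

lemma bounded_clinearI:
  assumes "\<And>x y. T (x + y) = T x + T y" "\<And>c x. T (c *\<^sub>C x) = c *\<^sub>C T x"
    and "\<And>x. norm (T x) \<le> norm x * K"
  shows "bounded_clinear T"
  unfolding bounded_clinear_def
  using assms by (auto intro!: bounded_linear_intro[where K = K] simp: scaleR_scaleC)

lemma bounded_antilinearI:
  assumes "\<And>x y. T (x + y) = T x + T y" "\<And>c x. T (c *\<^sub>C x) = cnj c *\<^sub>C T x"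
    and "\<And>x. norm (T x) \<le> norm x * K"
  shows "bounded_antilinear T"
  unfolding bounded_antilinear_def
  using assms by (auto intro!: bounded_linear_intro[where K = K] simp: scaleR_scaleC)

lemma bounded_clinear_linear: "bounded_clinear T \<Longrightarrow> linear T"
  by (simp add: bounded_clinear_def bounded_linear.linear)

lemma bounded_clinear_bounded_linear: "bounded_clinear T \<Longrightarrow> bounded_linear T"
  by (simp add: bounded_clinear_def)

lemma bounded_clinear_scaleC: "bounded_clinear T \<Longrightarrow> T (c *\<^sub>C x) = c *\<^sub>C T x"
  by (simp add: bounded_clinear_def)

lemma bounded_antilinear_linear: "bounded_antilinear T \<Longrightarrow> linear T"
  by (simp add: bounded_antilinear_def bounded_linear.linear)

lemma bounded_antilinear_scaleC: "bounded_antilinear T \<Longrightarrow> T (c *\<^sub>C x) = cnj c *\<^sub>C T x"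
  by (simp add: bounded_antilinear_def)

lemma bounded_clinear_compose:
  "bounded_clinear A \<Longrightarrow> bounded_clinear B \<Longrightarrow> bounded_clinear (A \<circ> B)"
  by (auto simp: bounded_clinear_def o_def intro: bounded_linear_compose)

lemma bounded_clinear_id: "bounded_clinear id"
  by (auto simp: bounded_clinear_def id_def intro: bounded_linear_ident)

lemma bounded_antilinear_compose:
  "bounded_antilinear A \<Longrightarrow> bounded_antilinear B \<Longrightarrow> bounded_clinear (A \<circ> B)"
  by (auto simp: bounded_clinear_def bounded_antilinear_def o_def intro: bounded_linear_compose)

lemma bounded_antilinear_compose_clinear:
  "bounded_antilinear A \<Longrightarrow> bounded_clinear B \<Longrightarrow> bounded_antilinear (A \<circ> B)"
  by (auto simp: bounded_clinear_def bounded_antilinear_def o_def intro: bounded_linear_compose)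

lemma bounded_clinear_compose_antilinear:
  "bounded_clinear A \<Longrightarrow> bounded_antilinear B \<Longrightarrow> bounded_antilinear (A \<circ> B)"
  by (auto simp: bounded_clinear_def bounded_antilinear_def o_def intro: bounded_linear_compose)

lemma linear_isometry_inner:
  assumes "linear U" "\<And>x. norm (U x) = norm x"
  shows "inner (U x) (U y) = inner x y"
proof -
  have "(norm (U x + U y))\<^sup>2 = (norm (x + y))\<^sup>2"
    using assms(2)[of "x + y"] by (simp add: linear_add[OF assms(1)])
  moreover have "inner (U x) (U x) = inner x x" for x
    by (metis assms(2) power2_norm_eq_inner)
  ultimately show ?thesis
    by (simp add: power2_norm_eq_inner inner_simps inner_commute)
qed

text \<open>Polarization of the norm gives real parts only. The imaginary part is a real part with
  \<i> on the left argument, which antilinearity draws into \<open>U\<close> as -\<i>; hence the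
  swapped order of the arguments.\<close>

lemma antilinear_isometry_cinner:
  assumes U: "bounded_antilinear U" and n: "\<And>x. norm (U x) = norm x"
  shows "cinner (U x) (U y) = cinner y x"
proof (rule complex_eqI)
  note inner_U = linear_isometry_inner[OF bounded_antilinear_linear[OF U] n]
  show "Re (cinner (U x) (U y)) = Re (cinner y x)"
    using inner_U by (metis inner_cinner inner_commute)
  have "Im (cinner (U x) (U y)) = inner (U ((- \<i>) *\<^sub>C x)) (U y)"
    by (simp add: Im_cinner bounded_antilinear_scaleC[OF U])
  also have "\<dots> = inner ((- \<i>) *\<^sub>C x) y" by (rule inner_U)
  also have "\<dots> = - Im (cinner x y)" by (simp add: inner_cinner cinner_scaleC_left)
  also have "\<dots> = Im (cinner y x)" by (metis cinner_commute cnj.simps(2))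
  finally show "Im (cinner (U x) (U y)) = Im (cinner y x)" .
qed

section \<open>Riesz representation and adjoints\<close>

lemma riesz_representation:
  fixes f :: "'a::chilbert_space \<Rightarrow> complex"
  assumes f: "bounded_linear f" and fc: "\<And>c x. f (c *\<^sub>C x) = c * f x"
  shows "\<exists>z. \<forall>x. f x = cinner z x"
proof (cases "\<forall>x. f x = 0")
  case True
  thus ?thesis by (intro exI[of _ 0]) simp
next
  case False
  note lin = bounded_linear.linear[OF f]
  let ?M = "{x. f x = 0}"
  have M: "subspace ?M"
    unfolding subspace_def
    by (auto simp: linear_0[OF lin] linear_add[OF lin] linear_scale[OF lin])
  have "closed ?M"
    by (intro closed_Collect_eq linear_continuous_on f continuous_on_const)
  then obtain z where z: "z \<noteq> 0" "\<And>m. f m = 0 \<Longrightarrow> inner z m = 0"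
    using ex_orthogonal_to_closed_subspace[OF M] False by blast
  \<comment> \<open>So far \<open>z\<close> is orthogonal to the kernel only for the real inner
    product; the kernel is stable under multiplication by -\<i>, which adds the imaginary
    part.\<close>
  have zc: "cinner z m = 0" if "f m = 0" for m
  proof (rule complex_eqI)
    show "Re (cinner z m) = Re 0" using z(2)[OF that] by (simp add: inner_cinner)
    have "inner z ((- \<i>) *\<^sub>C m) = 0" using that by (intro z(2)) (simp add: fc)
    thus "Im (cinner z m) = Im 0" by (simp add: inner_cinner cinner_scaleC_right)
  qed
  have fz: "f z \<noteq> 0" using z(1) z(2)[of z] by auto
  have zz: "cinner z z \<noteq> 0" using z(1) by (simp add: cinner_self)
  have "f x = cinner (cnj (f z / cinner z z) *\<^sub>C z) x" for x
  proof -
    have "f (x - (f x / f z) *\<^sub>C z) = 0" using fz by (simp add: linear_diff[OF lin] fc)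
    from zc[OF this] have "cinner z x = f x / f z * cinner z z"
      by (simp add: cinner_diff_right cinner_scaleC_right)
    thus ?thesis using fz zz by (simp add: cinner_scaleC_left)
  qed
  thus ?thesis by blast
qed

lemma cadjoint_unique:
  assumes "\<And>v w. cinner (A v) w = cinner v (T w)"
  shows "cadjoint T = A"
  unfolding cadjoint_def
proof (rule the_equality)
  fix A' assume "\<forall>v w. cinner (A' v) w = cinner v (T w)"
  thus "A' = A" by (intro ext cinner_ext_left) (simp add: assms)
qed (simp add: assms)

lemma cinner_cadjoint_left:
  fixes T :: "'a::chilbert_space \<Rightarrow> 'a"
  assumes T: "bounded_clinear T"
  shows "cinner (cadjoint T v) w = cinner v (T w)"
proof -
  have "\<exists>z. \<forall>w. cinner v (T w) = cinner z w" for v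
    using bounded_linear_compose[OF bounded_linear_cinner_right
        bounded_clinear_bounded_linear[OF T]]
    by (intro riesz_representation) (auto simp: bounded_clinear_scaleC[OF T] cinner_scaleC_right)
  then obtain A where A: "\<And>v w. cinner v (T w) = cinner (A v) w" by metis
  show ?thesis unfolding cadjoint_unique[of A T, OF A[symmetric]] A ..
qed

lemma cinner_cadjoint_right:
  fixes T :: "'a::chilbert_space \<Rightarrow> 'a"
  assumes T: "bounded_clinear T"
  shows "cinner v (cadjoint T w) = cinner (T v) w"
  by (metis T cinner_cadjoint_left cinner_commute)

text \<open>The constant \<open>K\<close> is kept because the crossing map of an antiunitary
  involution arises as the adjoint of a contraction and must again be one.\<close>

lemma norm_cadjoint_le:
  fixes T :: "'a::chilbert_space \<Rightarrow> 'a"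
  assumes T: "bounded_clinear T" and K: "\<And>x. norm (T x) \<le> norm x * K"
  shows "norm (cadjoint T x) \<le> norm x * K"
proof -
  have "(norm (cadjoint T x))\<^sup>2 = cmod (cinner x (T (cadjoint T x)))"
    by (simp add: cinner_self norm_power flip: cinner_cadjoint_left[OF T])
  also have "\<dots> \<le> norm x * (norm (cadjoint T x) * K)"
    by (rule order_trans[OF norm_cinner_le mult_left_mono[OF K]]) simp
  finally show ?thesis
    by (cases "norm (cadjoint T x) = 0")
      (use order_trans[OF norm_ge_zero K[of x]] in \<open>simp_all add: power2_eq_square\<close>)
qed

lemma bounded_clinear_cadjoint:
  fixes T :: "'a::chilbert_space \<Rightarrow> 'a"
  assumes T: "bounded_clinear T"
  shows "bounded_clinear (cadjoint T)"
proof -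
  obtain K where K: "\<And>x. norm (T x) \<le> norm x * K"
    using bounded_linear.bounded[OF bounded_clinear_bounded_linear[OF T]] by auto
  show ?thesis
  proof (rule bounded_clinearI)
    show "norm (cadjoint T x) \<le> norm x * K" for x by (rule norm_cadjoint_le[OF T K])
  qed (rule cinner_ext_left;
      simp add: cinner_cadjoint_left[OF T] cinner_add_left cinner_scaleC_left)+
qed

lemma cadjoint_cadjoint:
  fixes T :: "'a::chilbert_space \<Rightarrow> 'a"
  assumes T: "bounded_clinear T"
  shows "cadjoint (cadjoint T) = T"
  by (rule cadjoint_unique) (simp add: cinner_cadjoint_right[OF T])

lemma antilinear_adjoint_unique:
  assumes "\<And>v w. cinner v (S w) = cinner w (A v)"
  shows "antilinear_adjoint S = A"
  unfolding antilinear_adjoint_def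
proof (rule the_equality)
  fix A' assume "\<forall>v w. cinner v (S w) = cinner w (A' v)"
  thus "A' = A" by (intro ext cinner_ext_right) (metis assms)
qed (simp add: assms)

text \<open>The functional to be represented is antilinear in \<open>w\<close>, so the Riesz
  representation is applied to its complex conjugate.\<close>

lemma cinner_antilinear_adjoint:
  fixes S :: "'a::chilbert_space \<Rightarrow> 'a"
  assumes S: "bounded_antilinear S"
  shows "cinner v (S w) = cinner w (antilinear_adjoint S v)"
proof -
  have "bounded_linear (\<lambda>w. cnj (cinner v (S w)))" for v
    using S unfolding bounded_antilinear_def
    by (intro bounded_linear_compose[OF bounded_linear_cnj]
        bounded_linear_compose[OF bounded_linear_cinner_right]) auto
  hence "\<exists>z. \<forall>w. cnj (cinner v (S w)) = cinner z w" for v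
    by (intro riesz_representation) (auto simp: bounded_antilinear_scaleC[OF S] cinner_scaleC_right)
  then obtain A where "\<And>v w. cnj (cinner v (S w)) = cinner (A v) w" by metis
  hence A: "\<And>v w. cinner v (S w) = cinner w (A v)"
    by (metis cinner_commute complex_cnj_cnj)
  show ?thesis unfolding antilinear_adjoint_unique[of S A, OF A] by (rule A)
qed

lemma bounded_antilinear_antilinear_adjoint:
  fixes S :: "'a::chilbert_space \<Rightarrow> 'a"
  assumes S: "bounded_antilinear S"
  shows "bounded_antilinear (antilinear_adjoint S)"
proof -
  let ?A = "antilinear_adjoint S"
  note adj = cinner_antilinear_adjoint[OF S, symmetric]
  obtain K where K: "\<And>x. norm (S x) \<le> norm x * K"
    using S bounded_linear.bounded[of S] by (auto simp: bounded_antilinear_def)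
  show ?thesis
  proof (rule bounded_antilinearI)
    fix x
    have "(norm (?A x))\<^sup>2 = cmod (cinner x (S (?A x)))"
      by (simp add: cinner_self norm_power flip: adj)
    also have "\<dots> \<le> norm x * (norm (?A x) * K)"
      by (rule order_trans[OF norm_cinner_le mult_left_mono[OF K]]) simp
    finally show "norm (?A x) \<le> norm x * K"
      by (cases "norm (?A x) = 0")
        (use order_trans[OF norm_ge_zero K[of x]] in \<open>simp_all add: power2_eq_square\<close>)
  qed (rule cinner_ext_right; simp add: adj cinner_add_left cinner_add_right
      cinner_scaleC_left cinner_scaleC_right)+
qed

section \<open>Positive operators\<close>

lemma positive_op_bounded_clinear: "positive_op P \<Longrightarrow> bounded_clinear P"
  by (simp add: positive_op_def)

lemma positive_op_inner: "positive_op P \<Longrightarrow> 0 \<le> inner x (P x)"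
  by (simp add: positive_op_def inner_cinner)

text \<open>Polarization: real diagonal values at \<open>x + y\<close> relate the imaginary parts of
  the two mixed terms, those at \<open>x + \<i> *\<^sub>C y\<close> their real parts.\<close>

lemma positive_op_symmetric:
  assumes P: "positive_op P"
  shows "cinner (P x) y = cinner x (P y)"
proof -
  note l = linear_add[OF bounded_clinear_linear[OF positive_op_bounded_clinear[OF P]]]
    bounded_clinear_scaleC[OF positive_op_bounded_clinear[OF P]]
  have im: "Im (cinner x (P x)) = 0" for x using P by (simp add: positive_op_def)
  have "Im (cinner x (P y)) + Im (cinner y (P x)) = 0"
    using im[of "x + y"] im[of x] im[of y] by (simp add: l cinner_add_left cinner_add_right)
  moreover have "Re (cinner x (P y)) = Re (cinner y (P x))"
    using im[of "x + \<i> *\<^sub>C y"] im[of x] im[of y]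
    by (simp add: l cinner_add_left cinner_add_right cinner_scaleC_left cinner_scaleC_right)
  ultimately have "cinner x (P y) = cnj (cinner y (P x))" by (simp add: complex_eq_iff)
  thus ?thesis using cinner_commute by metis
qed

lemma positive_op_inner_symmetric:
  "positive_op P \<Longrightarrow> inner (P x) y = inner x (P y)"
  by (simp add: positive_op_symmetric inner_cinner)

lemma positive_op_kernel:
  assumes P: "positive_op P" and 0: "inner x (P x) = 0"
  shows "P x = 0"
proof (rule ccontr)
  assume "P x \<noteq> 0"
  hence n: "inner (P x) (P x) > 0" by simp
  let ?c = "inner (P x) (P (P x))"
  note l = linear_add[OF bounded_clinear_linear[OF positive_op_bounded_clinear[OF P]]]
    linear_scale[OF bounded_clinear_linear[OF positive_op_bounded_clinear[OF P]]]
  \<comment> \<open>Moving from \<open>x\<close> to \<open>x - t P x\<close> gives the form the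
    value \<open>t (t ?c - 2 inner (P x) (P x))\<close>, negative for small positive
    \<open>t\<close>; the 1 in the denominator covers \<open>?c = 0\<close>.\<close>
  define t where "t = inner (P x) (P x) / (?c + 1)"
  have c: "?c \<ge> 0" by (rule positive_op_inner[OF P])
  have t: "t > 0" using n c by (simp add: t_def)
  have "0 \<le> inner (x + (- t) *\<^sub>R P x) (P (x + (- t) *\<^sub>R P x))" by (rule positive_op_inner[OF P])
  also have "\<dots> = t * (t * ?c - 2 * inner (P x) (P x))"
    unfolding l
    using 0 by (simp add: inner_diff_left inner_diff_right algebra_simps
        flip: positive_op_inner_symmetric[OF P, of x])
  finally have "2 * inner (P x) (P x) \<le> t * ?c" using t by (simp add: zero_le_mult_iff)
  also have "t * ?c \<le> t * (?c + 1)" using t by simp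
  also have "\<dots> = inner (P x) (P x)" using c by (simp add: t_def)
  finally show False using n by simp
qed

text \<open>
  Following Riesz and Nagy, \<open>B = \<Sum>\<^sub>k C\<^sub>k\<^sup>2\<close> strongly for \<open>0 \<le> B \<le> 1\<close> and \<open>C\<^sub>0 = B\<close>,
  \<open>C\<^sub>k\<^sub>+\<^sub>1 = C\<^sub>k - C\<^sub>k\<^sup>2\<close>. As \<open>A\<close> commutes with every \<open>C\<^sub>k\<close>, this replaces the square root
  of \<open>B\<close> in \<open>\<langle>x, A B x\<rangle> = \<Sum>\<^sub>k \<langle>C\<^sub>k x, A C\<^sub>k x\<rangle>\<close>.
\<close>

lemma inner_commuting_positive_nonneg:
  fixes A B :: "'a::real_inner \<Rightarrow> 'a"
  assumes A: "linear A" and B: "bounded_linear B"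
    and symA: "\<And>x y. inner (A x) y = inner x (A y)" and symB: "\<And>x y. inner (B x) y = inner x (B y)"
    and posA: "\<And>x. 0 \<le> inner x (A x)" and posB: "\<And>x. 0 \<le> inner x (B x)"
    and comm: "\<And>x. A (B x) = B (A x)"
  shows "0 \<le> inner x (A (B x))"
proof -
  obtain K where K: "K > 0" "\<And>x. norm (B x) \<le> norm x * K"
    using bounded_linear.pos_bounded[OF B] by auto
  \<comment> \<open>\<open>K\<close> bounds the norm of \<open>B\<close>, so \<open>B / K\<close>
    lies between 0 and 1 as the iteration requires; the factor is removed at the end.\<close>
  define C where "C n = ((\<lambda>C x. C x - C (C x)) ^^ n) (\<lambda>x. B x /\<^sub>R K)" for n
  have C0: "C 0 x = B x /\<^sub>R K" for x by (simp add: C_def)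
  have CS: "C (Suc n) x = C n x - C n (C n x)" for n x by (simp add: C_def)
  have inv: "linear (C n) \<and> (\<forall>x y. inner (C n x) y = inner x (C n y)) \<and>
      (\<forall>x. 0 \<le> inner x (C n x) \<and> inner x (C n x) \<le> inner x x) \<and> (\<forall>x. A (C n x) = C n (A x))" for n
  proof (induction n)
    case 0
    have "inner x (B x) \<le> inner x x * K" for x
    proof -
      have "inner x (B x) \<le> norm x * norm (B x)" by (rule norm_cauchy_schwarz)
      also have "\<dots> \<le> norm x * (norm x * K)" by (intro mult_left_mono K) auto
      finally show ?thesis by (simp add: power2_eq_square flip: power2_norm_eq_inner)
    qed
    thus ?case
      using K(1) posB bounded_linear.linear[OF B]
      by (auto simp: C0 symB linear_scale[OF A] comm divide_inverse[symmetric] field_simps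
          intro!: linear_compose_scale_right)
  next
    case (Suc n)
    note l = linear_add[OF conjunct1[OF Suc]] linear_diff[OF conjunct1[OF Suc]]
      linear_scale[OF conjunct1[OF Suc]]
    have lin: "linear (C (Suc n))"
      by (rule linearI) (simp_all add: CS l algebra_simps)
    have sym: "inner (C n x) y = inner x (C n y)" for x y using Suc by blast
    have ineq: "0 \<le> inner x (C n x)" "inner x (C n x) \<le> inner x x" for x using Suc by blast+
    have pos: "0 \<le> inner x (C (Suc n) x)" for x
    proof -
      \<comment> \<open>C - C^2 = C (1 - C) C + (1 - C) C (1 - C), and both terms are nonnegative by
        the induction hypothesis.\<close>
      have "inner x (C (Suc n) x) = (inner (C n x) (C n x) - inner (C n x) (C n (C n x))) +
          inner (x - C n x) (C n (x - C n x))"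
        by (simp add: CS l inner_diff_left inner_diff_right sym)
      thus ?thesis using ineq(2)[of "C n x"] ineq(1)[of "x - C n x"] by simp
    qed
    have le: "inner x (C (Suc n) x) \<le> inner x x" for x
      using ineq(2)[of x] inner_ge_zero[of "C n x"] by (simp add: CS inner_diff_right sym)
    have "A (C (Suc n) x) = C (Suc n) (A x)" for x
      using Suc by (simp add: CS linear_diff[OF A])
    moreover have "inner (C (Suc n) x) y = inner x (C (Suc n) y)" for x y
      by (simp add: CS inner_diff_left inner_diff_right sym)
    ultimately show ?case using lin pos le by blast
  qed
  have sym: "inner (C n x) y = inner x (C n y)" and pos: "0 \<le> inner x (C n x)"
    and commC: "A (C n x) = C n (A x)" for n x y
    using inv by blast+
  have sq: "(\<Sum>k<n. C k (C k x)) = C 0 x - C n x" for n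
    by (induction n) (simp_all add: CS)
  have "(\<Sum>k<n. (norm (C k x))\<^sup>2) \<le> inner x (C 0 x)" for n
  proof -
    have "(\<Sum>k<n. (norm (C k x))\<^sup>2) = inner x (\<Sum>k<n. C k (C k x))"
      by (simp add: inner_sum_right sym power2_norm_eq_inner)
    thus ?thesis using pos[of x n] by (simp add: sq inner_diff_right)
  qed
  hence "summable (\<lambda>k. (norm (C k x))\<^sup>2)"
    by (intro summableI_nonneg_bounded) auto
  hence "(\<lambda>n. (norm (C n x))\<^sup>2) \<longlonglongrightarrow> 0" by (rule summable_LIMSEQ_zero)
  hence "(\<lambda>n. sqrt ((norm (C n x))\<^sup>2)) \<longlonglongrightarrow> sqrt 0" by (rule tendsto_real_sqrt)
  hence C_null: "(\<lambda>n. C n x) \<longlonglongrightarrow> 0" by (simp add: tendsto_norm_zero_iff)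
  have "0 \<le> inner (A x) (C 0 x - 0)"
  proof (rule LIMSEQ_le_const)
    show "(\<lambda>n. inner (A x) (C 0 x - C n x)) \<longlonglongrightarrow> inner (A x) (C 0 x - 0)"
      by (intro tendsto_intros C_null)
    have "0 \<le> (\<Sum>k<n. inner (C k x) (A (C k x)))" for n by (intro sum_nonneg posA)
    also have "(\<Sum>k<n. inner (C k x) (A (C k x))) = inner (A x) (C 0 x - C n x)" for n
      by (simp add: inner_sum_right commC sym symA flip: sq)
    finally show "\<exists>N. \<forall>n\<ge>N. 0 \<le> inner (A x) (C 0 x - C n x)" by blast
  qed
  hence "0 \<le> inner x (A (B x)) / K" by (simp add: C0 symA divide_inverse mult.commute linear_scale[OF A])
  thus ?thesis using K(1) by (simp add: zero_le_divide_iff)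
qed

lemma positive_op_commuting_compose:
  assumes A: "positive_op A" and B: "positive_op B" and comm: "A \<circ> B = B \<circ> A"
  shows "positive_op (A \<circ> B)"
proof -
  have c: "A (B x) = B (A x)" for x using comm by (metis comp_apply)
  have "0 \<le> inner x (A (B x))" for x
    by (rule inner_commuting_positive_nonneg)
      (auto simp: c positive_op_inner[OF A] positive_op_inner[OF B]
        positive_op_inner_symmetric[OF A] positive_op_inner_symmetric[OF B]
        bounded_clinear_linear bounded_clinear_bounded_linear
        positive_op_bounded_clinear A B)
  moreover have "Im (cinner x (A (B x))) = 0" for x
  proof -
    have "cinner x (A (B x)) = cinner (A (B x)) x"
      by (simp add: c positive_op_symmetric[OF A] positive_op_symmetric[OF B])
    thus ?thesis by (metis cinner_commute Reals_cnj_iff complex_is_Real_iff)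
  qed
  ultimately show ?thesis
    using bounded_clinear_compose[OF A[THEN positive_op_bounded_clinear]
        B[THEN positive_op_bounded_clinear]]
    by (simp add: positive_op_def inner_cinner)
qed

text \<open>
  The difference \<open>X = P - Q\<close> anticommutes with \<open>R = P + Q\<close>, so \<open>R\<close> commutes with \<open>X\<^sup>2\<close> and
  \<open>0 \<le> \<langle>x, R X\<^sup>2 x\<rangle> = - \<langle>X x, R X x\<rangle> \<le> 0\<close>.
\<close>

lemma positive_square_root_unique:
  assumes P: "positive_op P" and Q: "positive_op Q" and inj: "\<And>x. P x = 0 \<Longrightarrow> x = 0"
    and sq: "\<And>x. P (P x) = Q (Q x)"
  shows "P = Q"
proof
  fix x
  define X where "X y = P y - Q y" for y
  define R where "R y = P y + Q y" for y
  note bP = bounded_clinear_bounded_linear[OF positive_op_bounded_clinear[OF P]]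
  note bQ = bounded_clinear_bounded_linear[OF positive_op_bounded_clinear[OF Q]]
  note lP = bounded_linear.linear[OF bP] and lQ = bounded_linear.linear[OF bQ]
  note l = linear_add[OF lP] linear_diff[OF lP] linear_add[OF lQ] linear_diff[OF lQ]
  note sym = positive_op_inner_symmetric[OF P] positive_op_inner_symmetric[OF Q]
  have bX: "bounded_linear X" and bR: "bounded_linear R"
    unfolding X_def R_def by (intro bounded_linear_sub bounded_linear_add bP bQ)+
  have anti: "R (X y) = - X (R y)" for y
    by (simp add: X_def R_def l sq algebra_simps)
  have symX: "inner (X y) z = inner y (X z)" and symR: "inner (R y) z = inner y (R z)" for y z
    by (auto simp: X_def R_def sym inner_diff_left inner_diff_right inner_add_left inner_add_right)
  have posR: "0 \<le> inner y (R y)" for y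
    by (simp add: R_def inner_add_right positive_op_inner P Q)
  have "0 \<le> inner x (R (X (X x)))"
  proof (rule inner_commuting_positive_nonneg[OF bounded_linear.linear[OF bR]])
    show "bounded_linear (\<lambda>y. X (X y))" by (rule bounded_linear_compose[OF bX bX])
    show "R (X (X y)) = X (X (R y))" for y
      by (simp add: anti linear_neg[OF bounded_linear.linear[OF bX]])
    show "0 \<le> inner y (X (X y))" for y by (metis symX inner_ge_zero)
  qed (simp_all add: symX symR posR)
  also have "inner x (R (X (X x))) = - inner (X x) (R (X x))"
    by (simp only: anti[of "X x"] inner_minus_right symX)
  \<comment> \<open>\<open>P\<close> and \<open>Q\<close> both contribute nonnegatively to the form
    of \<open>R\<close>, so each contribution vanishes; \<open>P\<close> is the one known to be
    injective.\<close>
  finally have "inner (X x) (P (X x)) = 0"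
    using positive_op_inner[OF P, of "X x"] positive_op_inner[OF Q, of "X x"]
    by (simp add: R_def inner_add_right)
  hence "X x = 0" using positive_op_kernel[OF P] inj by blast
  thus "P x = Q x" by (simp add: X_def)
qed

section \<open>Bounded antilinear involutions\<close>

lemma antilinear_adjoint_involution:
  fixes S :: "'a::chilbert_space \<Rightarrow> 'a"
  assumes S: "bounded_antilinear_involution S"
  shows "antilinear_adjoint S (antilinear_adjoint S v) = v"
proof (rule cinner_ext_right)
  fix w
  have anti: "bounded_antilinear S" and inv: "S (S x) = x" for x
    using S by (auto simp: bounded_antilinear_involution_def)
  have "cinner w (antilinear_adjoint S (antilinear_adjoint S v)) = cinner (antilinear_adjoint S v) (S w)"
    by (rule cinner_antilinear_adjoint[OF anti, symmetric])
  also have "\<dots> = cnj (cinner v (S (S w)))"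
    by (metis cinner_antilinear_adjoint[OF anti] cinner_commute)
  also have "\<dots> = cinner w v" by (metis inv cinner_commute)
  finally show "cinner w (antilinear_adjoint S (antilinear_adjoint S v)) = cinner w v" .
qed

text \<open>
  \<open>J D J\<close> is the inverse of \<open>D\<close>, and so is \<open>J D J\<^sup>-\<^sup>1\<close> up to the unitary \<open>J\<^sup>2\<close>; uniqueness of
  positive square roots removes this unitary.
\<close>

lemma involution_polar_decomposition:
  fixes S J D :: "'a::complex_inner \<Rightarrow> 'a"
  assumes S: "bounded_antilinear_involution S"
    and polar: "antilinear_polar_decomposition S J D"
  shows "bounded_antilinear_involution J" "norm (J x) = norm x"
    "D (S (J x)) = x" "S (J (D x)) = x" "positive_op (S \<circ> J)"
proof -
  have J: "bounded_antilinear J" and pJ: "partial_isometry J" and D: "positive_op D"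
    and SJD: "S x = J (D x)" and kerJ: "J x = 0 \<longleftrightarrow> D x = 0" for x
    using polar by (auto simp: antilinear_polar_decomposition_def set_eq_iff)
  have bS: "bounded_antilinear S" and SS: "S (S x) = x" for x
    using S by (auto simp: bounded_antilinear_involution_def)
  note lJ = bounded_antilinear_linear[OF J] and bD = positive_op_bounded_clinear[OF D]
  have kerD: "x = 0" if "D x = 0" for x
  proof -
    have "S x = 0" using that linear_0[OF lJ] by (simp add: SJD)
    thus "x = 0" using SS[of x] linear_0[OF bounded_antilinear_linear[OF bS]] by simp
  qed
  \<comment> \<open>The kernel of \<open>J\<close> is that of \<open>D\<close>, hence zero, so every
    vector lies in the initial space of the partial isometry.\<close>
  show n: "norm (J x) = norm x" for x
    using pJ kerJ kerD unfolding partial_isometry_def by (metis cinner_zero_left)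
  note cJ = antilinear_isometry_cinner[OF J n]
  have injJ: "J x = J y \<Longrightarrow> x = y" for x y
    using n[of "x - y"] by (simp add: linear_diff[OF lJ])
  have invJ: "J (D (S x)) = x" for x by (metis SJD SS)
  show DSJ: "D (S (J x)) = x" for x by (rule injJ) (rule invJ)
  show SJD1: "S (J (D x)) = x" for x by (metis SJD SS)
  have bQ: "bounded_clinear (S \<circ> J)" by (rule bounded_antilinear_compose[OF bS J])
  show Q: "positive_op (S \<circ> J)"
    unfolding positive_op_def
  proof (intro conjI allI bQ)
    fix x
    have "cinner x ((S \<circ> J) x) = cinner (S (J x)) (D (S (J x)))"
      using positive_op_symmetric[OF D, of "S (J x)" "S (J x)"] by (simp add: DSJ)
    thus "Im (cinner x ((S \<circ> J) x)) = 0" "0 \<le> Re (cinner x ((S \<circ> J) x))"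
      using D by (simp_all add: positive_op_def)
  qed
  \<comment> \<open>By \<open>invJ\<close> the inverse of \<open>J\<close> is
    \<open>D \<circ> S\<close>, so \<open>P\<close> is \<open>D\<close> conjugated by
    \<open>J\<close>.\<close>
  define P where "P x = J (D (D (S x)))" for x
  have bP: "bounded_clinear P"
    using bounded_antilinear_compose[OF bounded_antilinear_compose_clinear
        [OF J bounded_clinear_compose[OF bD bD]] bS]
    unfolding P_def[abs_def] by (simp add: o_def)
  have P: "positive_op P"
    unfolding positive_op_def
  proof (intro conjI allI bP)
    fix x
    have "cinner x (P x) = cinner (J (D (S x))) (J (D (D (S x))))"
      by (simp add: P_def invJ)
    also have "\<dots> = cinner (D (S x)) (D (D (S x)))"
      by (simp add: cJ positive_op_symmetric[OF D])
    finally show "Im (cinner x (P x)) = 0" "0 \<le> Re (cinner x (P x))"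
      using D by (simp_all add: positive_op_def)
  qed
  have QP: "S (J x) = P (J (J x))" for x unfolding P_def DSJ by (rule SJD)
  \<comment> \<open>With Q = S J, \<open>QP\<close> reads Q = P J^2. Its adjoint is Q = J^(-2) P,
    that is, J^2 Q = P. Together they give Q Q = P J^2 Q = P P, so that Q and P are positive roots
    of the same operator.\<close>
  have JQ: "J (J (S (J x))) = P x" for x
  proof (rule cinner_ext_left)
    fix v
    obtain y where v: "v = J (J y)" by (metis invJ)
    have "cinner (J (J (S (J x)))) (J (J y)) = cinner (S (J x)) y" by (simp add: cJ)
    also have "\<dots> = cinner x (S (J y))" using positive_op_symmetric[OF Q, of x y] by simp
    also have "\<dots> = cinner (P x) (J (J y))" by (simp add: QP positive_op_symmetric[OF P])
    finally show "cinner (J (J (S (J x)))) v = cinner (P x) v" unfolding v .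
  qed
  have "S \<circ> J = P"
  proof (rule positive_square_root_unique[OF Q P])
    show "x = 0" if "(S \<circ> J) x = 0" for x
      using that DSJ[of x] linear_0[OF bounded_clinear_linear[OF bD]] by simp
    show "(S \<circ> J) ((S \<circ> J) x) = P (P x)" for x
      by (simp add: QP[of "S (J x)"] JQ)
  qed
  hence "J (J (P x)) = P x" for x using JQ[of x] by (metis comp_apply)
  moreover have "\<exists>y. x = P y" for x
    by (metis \<open>S \<circ> J = P\<close> SJD1 comp_apply)
  ultimately show "bounded_antilinear_involution J"
    using J unfolding bounded_antilinear_involution_def by metis
qed

lemma antiunitary_involution_adjoint:
  fixes J :: "'a::complex_inner \<Rightarrow> 'a"
  assumes "bounded_antilinear_involution J" "\<And>x. norm (J x) = norm x"
  shows "antilinear_adjoint J = J"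
  by (rule antilinear_adjoint_unique)
    (metis assms antilinear_isometry_cinner bounded_antilinear_involution_def)

text \<open>Being everywhere defined, \<open>\<sigma>\<close> splits each \<open>x\<close> into a
  real part (x + \<sigma> x)/2 and an imaginary part (x - \<sigma> x)/(2\<i>), both fixed by
  \<open>\<sigma>\<close>. So K + iK is the whole space rather than merely dense in it, and
  \<open>K\<close> is closed by continuity.\<close>

lemma involution_fixed_points_standard:
  fixes \<sigma> :: "'a::complex_inner \<Rightarrow> 'a"
  assumes \<sigma>: "bounded_antilinear_involution \<sigma>"
  defines "K \<equiv> {x. \<sigma> x = x}"
  shows "standard_subspace K" "tomita_graph K = {(x, \<sigma> x) |x. True}"
proof -
  have b: "bounded_linear \<sigma>" and c: "\<sigma> (c *\<^sub>C x) = cnj c *\<^sub>C \<sigma> x" and inv: "\<sigma> (\<sigma> x) = x" for c x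
    using \<sigma> by (auto simp: bounded_antilinear_involution_def bounded_antilinear_def)
  note lin = bounded_linear.linear[OF b]
  note l = linear_add[OF lin] linear_diff[OF lin] linear_scale[OF lin]
  have dec: "\<exists>h k. h \<in> K \<and> k \<in> K \<and> x = h + \<i> *\<^sub>C k" for x
  proof (intro exI conjI)
    show "(1/2) *\<^sub>R (x + \<sigma> x) \<in> K" by (simp add: K_def l inv add.commute)
    show "(- \<i>/2) *\<^sub>C (x - \<sigma> x) \<in> K"
      by (simp add: K_def l c inv scaleC_diff_right scaleC_minus_left)
    have "\<i> *\<^sub>C (- \<i>/2) *\<^sub>C (x - \<sigma> x) = (1/2) *\<^sub>R (x - \<sigma> x)"
      by (simp add: scaleC_scaleC scaleR_scaleC)
    moreover have "(1/2) *\<^sub>R (x + \<sigma> x) + (1/2) *\<^sub>R (x - \<sigma> x) = x"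
      by (simp add: algebra_simps flip: scaleR_add_left)
    ultimately show "x = (1/2) *\<^sub>R (x + \<sigma> x) + \<i> *\<^sub>C (- \<i>/2) *\<^sub>C (x - \<sigma> x)" by simp
  qed
  show "standard_subspace K"
    unfolding standard_subspace_def
  proof (intro conjI)
    show "subspace K" by (simp add: subspace_def K_def l linear_0[OF lin])
    show "closed K"
      unfolding K_def by (intro closed_Collect_eq linear_continuous_on b continuous_on_id)
    have "h = 0" if "h \<in> K" "h = \<i> *\<^sub>C k" "k \<in> K" for h k
    proof -
      have "\<sigma> h = - h" using that by (simp add: K_def c scaleC_minus_left)
      moreover have "\<sigma> h = h" using that by (simp add: K_def)
      ultimately have "2 *\<^sub>R h = 0" unfolding scaleR_2 by (simp add: eq_neg_iff_add_eq_0)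
      thus ?thesis by simp
    qed
    moreover have "0 \<in> K" by (simp add: K_def linear_0[OF lin])
    ultimately show "K \<inter> (*\<^sub>C) \<i> ` K = {0}" by force
    have "{h + \<i> *\<^sub>C k |h k. h \<in> K \<and> k \<in> K} = UNIV" using dec by blast
    thus "closure {h + \<i> *\<^sub>C k |h k. h \<in> K \<and> k \<in> K} = UNIV" by simp
  qed
  have img: "\<sigma> (h + \<i> *\<^sub>C k) = h - \<i> *\<^sub>C k" if "h \<in> K" "k \<in> K" for h k
    using that by (simp add: K_def l c scaleC_minus_left)
  show "tomita_graph K = {(x, \<sigma> x) |x. True}"
  proof (intro set_eqI iffI)
    fix p assume "p \<in> tomita_graph K"
    thus "p \<in> {(x, \<sigma> x) |x. True}" using img by (auto simp: tomita_graph_def)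
  next
    fix p assume "p \<in> {(x, \<sigma> x) |x. True}"
    then obtain x where p: "p = (x, \<sigma> x)" by blast
    obtain h k where "h \<in> K" "k \<in> K" "x = h + \<i> *\<^sub>C k" using dec by blast
    thus "p \<in> tomita_graph K" unfolding p tomita_graph_def by (auto simp: img)
  qed
qed

section \<open>Extension from dense subspaces\<close>

text \<open>\<open>span\<close> is the real span and pairs carry no complex structure of their own,
  so invariance under componentwise complex scalars has to be carried over from the
  generators.\<close>

lemma span_scaleC_closed:
  fixes X :: "('a::complex_inner \<times> 'b::complex_inner) set"
  assumes X: "\<And>x y. (x, y) \<in> X \<Longrightarrow> (c *\<^sub>C x, c *\<^sub>C y) \<in> X" and p: "(x, y) \<in> span X"
  shows "(c *\<^sub>C x, c *\<^sub>C y) \<in> span X"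
proof -
  let ?f = "\<lambda>p::'a \<times> 'b. (c *\<^sub>C fst p, c *\<^sub>C snd p)"
  have lin: "linear ?f"
    by (rule linearI) (auto simp: scaleC_add_right scaleR_scaleC scaleC_scaleC mult.commute)
  have "?f (x, y) \<in> ?f ` span X" using p by (rule imageI)
  also have "?f ` span X = span (?f ` X)" by (rule linear_span_image[OF lin, symmetric])
  also have "\<dots> \<subseteq> span X" using X by (intro span_mono) auto
  finally show ?thesis by simp
qed

lemma span_fst: "fst ` span X = span (fst ` X)"
  by (rule linear_span_image[symmetric]) (simp add: linear_iff)

text \<open>The operator is given by a graph, not by a function, because its values on sums of
  generators are not known in advance to be independent of the representation. The bound survives in
  the closure of the graph; at first component 0 it forces single-valuedness, and with completeness
  of the target it makes the closure total.\<close>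

lemma bounded_clinear_extension:
  fixes G :: "('a::complex_inner \<times> 'b::chilbert_space) set"
  assumes G: "subspace G" and cG: "\<And>c x y. (x, y) \<in> G \<Longrightarrow> (c *\<^sub>C x, c *\<^sub>C y) \<in> G"
    and bound: "\<And>x y. (x, y) \<in> G \<Longrightarrow> norm y \<le> norm x * K"
    and dense: "closure (fst ` G) = UNIV"
  shows "\<exists>F. bounded_clinear F \<and> (\<forall>x. norm (F x) \<le> norm x * K) \<and> (\<forall>x y. (x, y) \<in> G \<longrightarrow> F x = y)"
proof -
  let ?H = "closure G"
  have "?H \<subseteq> {p. norm (snd p) \<le> norm (fst p) * K}"
    by (rule closure_minimal) (auto simp: bound intro!: closed_Collect_le continuous_intros)
  hence boundH: "norm y \<le> norm x * K" if "(x, y) \<in> ?H" for x y using that by auto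
  have H: "subspace ?H" by (rule subspace_closure[OF G])
  have cH: "(c *\<^sub>C x, c *\<^sub>C y) \<in> ?H" if xy: "(x, y) \<in> ?H" for c x y
  proof -
    obtain p where p: "\<And>n. p n \<in> G" "p \<longlonglongrightarrow> (x, y)" using xy by (auto simp: closure_sequential)
    have "(\<lambda>n. (c *\<^sub>C fst (p n), c *\<^sub>C snd (p n))) \<longlonglongrightarrow> (c *\<^sub>C fst (x, y), c *\<^sub>C snd (x, y))"
      by (intro tendsto_Pair tendsto_scaleC tendsto_fst tendsto_snd p)
    moreover have "(c *\<^sub>C fst (p n), c *\<^sub>C snd (p n)) \<in> G" for n using p(1)[of n] by (intro cG) simp
    ultimately show ?thesis unfolding closure_sequential fst_conv snd_conv
      by (intro exI[of _ "\<lambda>n. (c *\<^sub>C fst (p n), c *\<^sub>C snd (p n))"]) blast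
  qed
  have ex: "\<exists>y. (x, y) \<in> ?H" for x
  proof -
    have "x \<in> closure (fst ` G)" using dense by simp
    then obtain q where q: "\<And>n. q n \<in> fst ` G" "q \<longlonglongrightarrow> x" by (auto simp: closure_sequential)
    have "\<forall>n. \<exists>y. (q n, y) \<in> G" using q(1) by force
    then obtain r where r: "\<And>n. (q n, r n) \<in> G" by metis
    have "Cauchy r"
    proof (rule metric_CauchyI)
      fix e :: real assume e: "0 < e"
      have "Cauchy q" using q(2) by (rule LIMSEQ_imp_Cauchy)
      moreover have "0 < e / (\<bar>K\<bar> + 1)" using e by simp
      ultimately obtain N where N: "\<And>m n. m \<ge> N \<Longrightarrow> n \<ge> N \<Longrightarrow> dist (q m) (q n) < e / (\<bar>K\<bar> + 1)"
        unfolding Cauchy_def by meson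
      have "dist (r m) (r n) < e" if "m \<ge> N" "n \<ge> N" for m n
      proof -
        have "norm (r m - r n) \<le> norm (q m - q n) * K"
          using subspace_diff[OF G r r, of m n] by (intro bound) simp
        also have "\<dots> \<le> norm (q m - q n) * (\<bar>K\<bar> + 1)" by (intro mult_left_mono) auto
        also have "\<dots> < e"
          using N[OF that] by (simp add: dist_norm pos_less_divide_eq)
        finally show ?thesis by (simp add: dist_norm)
      qed
      thus "\<exists>N. \<forall>m\<ge>N. \<forall>n\<ge>N. dist (r m) (r n) < e" by blast
    qed
    then obtain y where "r \<longlonglongrightarrow> y" by (auto simp: Cauchy_convergent_iff convergent_def)
    hence "(\<lambda>n. (q n, r n)) \<longlonglongrightarrow> (x, y)" using q(2) by (intro tendsto_Pair)
    thus ?thesis using r unfolding closure_sequential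
      by (intro exI[of _ y] exI[of _ "\<lambda>n. (q n, r n)"]) blast
  qed
  have uniq: "y = z" if "(x, y) \<in> ?H" "(x, z) \<in> ?H" for x y z
    using boundH[of 0 "y - z"] subspace_diff[OF H that] by simp
  define F where "F x = (SOME y. (x, y) \<in> ?H)" for x
  have F: "(x, F x) \<in> ?H" for x unfolding F_def by (rule someI_ex[OF ex])
  have "bounded_clinear F"
  proof (rule bounded_clinearI)
    show "F (x + y) = F x + F y" for x y
      by (rule uniq[OF F]) (use subspace_add[OF H F F, of x y] in simp)
    show "F (c *\<^sub>C x) = c *\<^sub>C F x" for c x by (rule uniq[OF F cH[OF F]])
    show "norm (F x) \<le> norm x * K" for x by (rule boundH[OF F])
  qed
  moreover have "F x = y" if "(x, y) \<in> G" for x y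
    by (rule uniq[OF F]) (use that closure_subset in blast)
  ultimately show ?thesis using boundH[OF F] by blast
qed

lemma bounded_linear_eq_on_dense:
  assumes f: "bounded_linear f" and g: "bounded_linear g"
    and eq: "\<And>x. x \<in> X \<Longrightarrow> f x = g x" and dense: "closure (span X) = UNIV"
  shows "f = g"
proof -
  have "subspace {x. f x = g x}"
    by (simp add: subspace_def linear_simps f g)
  hence "span X \<subseteq> {x. f x = g x}" using eq by (intro span_minimal) auto
  hence "closure (span X) \<subseteq> {x. f x = g x}"
    by (intro closure_minimal closed_Collect_eq linear_continuous_on f g)
  thus ?thesis using dense by auto
qed

section \<open>Expansion in an orthonormal basis\<close>

lemma orthonormal_expansion_bound:
  fixes E :: "'a::complex_inner set"
  assumes E: "orthonormal E" and F: "finite F" "F \<subseteq> E"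
  shows "norm (w - (\<Sum>e\<in>F. cinner e w *\<^sub>C e)) \<le> norm w"
proof -
  let ?P = "\<Sum>e\<in>F. cinner e w *\<^sub>C e"
  have "cinner f ?P = cinner f w" if f: "f \<in> F" for f
  proof -
    have "cinner f ?P = (\<Sum>e\<in>F. cinner e w * cinner f e)"
      by (simp add: cinner_sum_right cinner_scaleC_right)
    also have "\<dots> = (\<Sum>e\<in>F. if e = f then cinner f w else 0)"
      using E F f by (intro sum.cong) (auto simp: orthonormal_def subset_iff)
    finally show ?thesis using F f by simp
  qed
  hence "cinner (w - ?P) e = 0" if "e \<in> F" for e
    by (subst cinner_commute) (simp add: that cinner_diff_right)
  hence "cinner (w - ?P) ?P = 0" by (simp add: cinner_sum_right cinner_scaleC_right)
  hence 0: "inner (w - ?P) ?P = 0" by (simp add: inner_cinner)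
  have "(norm w)\<^sup>2 = (norm ((w - ?P) + ?P))\<^sup>2" by simp
  also have "\<dots> = (norm (w - ?P))\<^sup>2 + (norm ?P)\<^sup>2"
    unfolding power2_norm_eq_inner inner_add_left inner_add_right
    using 0 inner_commute[of ?P "w - ?P"] by simp
  finally show ?thesis by (simp add: power2_le_imp_le)
qed

text \<open>An approximant \<open>z\<close> from the span is reproduced exactly by every finite
  \<open>G\<close> containing its own basis vectors. The error for \<open>y\<close> is then the
  error for \<open>y - z\<close>, which is at most the norm of \<open>y - z\<close>.\<close>

lemma orthonormal_basis_has_sum:
  fixes E :: "'a::complex_inner set"
  assumes E: "orthonormal_basis E"
  shows "((\<lambda>e. cinner e y *\<^sub>C e) has_sum y) E"
  unfolding has_sum_def tendsto_iff eventually_finite_subsets_at_top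
proof (intro allI impI)
  have on: "orthonormal E" using E by (simp add: orthonormal_basis_def)
  fix \<epsilon> :: real assume \<epsilon>: "\<epsilon> > 0"
  have "y \<in> closure (cspan E)" using E by (simp add: orthonormal_basis_def)
  then obtain z where z: "z \<in> cspan E" "dist z y < \<epsilon>" using \<epsilon> by (meson closure_approachable)
  obtain F where F: "finite F" "F \<subseteq> E" "z = (\<Sum>e\<in>F. cinner e z *\<^sub>C e)"
    using cspan_expansion[OF on z(1)] by blast
  have "dist (\<Sum>e\<in>G. cinner e y *\<^sub>C e) y < \<epsilon>" if G: "finite G" "F \<subseteq> G" "G \<subseteq> E" for G
  proof -
    have "cinner e z = 0" if "e \<in> G - F" for e
    proof -
      have "cinner e z = (\<Sum>f\<in>F. cinner f z * cinner e f)"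
        by (subst F(3)) (simp add: cinner_sum_right cinner_scaleC_right)
      also have "\<dots> = 0"
        using on F G that by (intro sum.neutral) (auto simp: orthonormal_def subset_iff)
      finally show ?thesis .
    qed
    hence "(\<Sum>e\<in>G. cinner e z *\<^sub>C e) = (\<Sum>e\<in>F. cinner e z *\<^sub>C e)"
      using G by (intro sum.mono_neutral_right) auto
    hence Gz: "(\<Sum>e\<in>G. cinner e z *\<^sub>C e) = z" by (simp add: F(3)[symmetric])
    have "y - (\<Sum>e\<in>G. cinner e y *\<^sub>C e) =
        (y - z) - (\<Sum>e\<in>G. cinner e (y - z) *\<^sub>C e)"
      by (simp add: cinner_diff_right sum_subtractf scaleC_diff_left Gz)
    hence "norm (y - (\<Sum>e\<in>G. cinner e y *\<^sub>C e)) \<le> norm (y - z)"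
      using orthonormal_expansion_bound[OF on G(1,3), of "y - z"] by (simp only:)
    thus ?thesis using z(2) by (simp add: dist_norm norm_minus_commute)
  qed
  thus "\<exists>X. finite X \<and> X \<subseteq> E \<and> (\<forall>Y. finite Y \<and> X \<subseteq> Y \<and> Y \<subseteq> E \<longrightarrow>
      dist (\<Sum>e\<in>Y. cinner e y *\<^sub>C e) y < \<epsilon>)"
    using F by blast
qed

section \<open>Hilbert-Schmidt operators\<close>

lemma hilbert_schmidt_bounded_clinear: "hilbert_schmidt T \<Longrightarrow> bounded_clinear T"
  by (simp add: hilbert_schmidt_def)

lemma bounded_clinear_hs_apply: "bounded_clinear (hs_apply A)"
  by (rule hilbert_schmidt_bounded_clinear[OF hilbert_schmidt_hs_apply])

lemma hs_op_eqI: "(\<And>x. hs_apply A x = hs_apply B x) \<Longrightarrow> A = B"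
  by (rule hs_apply_inject[THEN iffD1]) (rule ext)

lemma hs_apply_hs_restrict:
  "preserves_hilbert_schmidt F \<Longrightarrow> hs_apply (hs_restrict F A) = F (hs_apply A)"
  unfolding hs_restrict_def preserves_hilbert_schmidt_def
  using hilbert_schmidt_hs_apply by (intro Abs_hs_op_inverse) blast

section \<open>Rank one operators\<close>

lemma hilbert_schmidt_rank_one:
  fixes u v :: "'a::chilbert_space"
  shows "hilbert_schmidt (\<lambda>x. cinner v x *\<^sub>C u)"
  unfolding hilbert_schmidt_def
proof
  show "bounded_clinear (\<lambda>x. cinner v x *\<^sub>C u)"
    by (rule bounded_clinearI[where K = "norm v * norm u"])
      (auto simp: cinner_add_right scaleC_add_left cinner_scaleC_right scaleC_scaleC norm_scaleC
        intro: order_trans[OF mult_right_mono[OF norm_cinner_le]])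
  \<comment> \<open>Parseval: pairing the expansion of \<open>v\<close> with \<open>v\<close> itself
    gives the series of squared coefficients, which is the required sum up to the squared norm of
    \<open>u\<close>.\<close>
  have "((\<lambda>e. cinner v (cinner e v *\<^sub>C e)) has_sum cinner v v) (some_onb :: 'a set)"
    by (rule has_sum_bounded_linear[OF bounded_linear_cinner_right
        orthonormal_basis_has_sum[OF orthonormal_basis_some_onb]])
  hence "(\<lambda>e. Re (cinner v (cinner e v *\<^sub>C e))) summable_on (some_onb :: 'a set)"
    by (intro summable_on_Re has_sum_imp_summable)
  moreover have "Re (cinner v (cinner e v *\<^sub>C e)) = (cmod (cinner v e))\<^sup>2" for e
  proof -
    have "cinner v (cinner e v *\<^sub>C e) = cinner v e * cnj (cinner v e)"
      by (subst cinner_commute[of e]) (simp add: cinner_scaleC_right)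
    thus ?thesis by (metis Re_complex_of_real complex_norm_square)
  qed
  ultimately show "(\<lambda>e. (norm (cinner v e *\<^sub>C u))\<^sup>2) summable_on some_onb"
    by (simp add: norm_scaleC power_mult_distrib summable_on_cmult_left)
qed

lift_definition ketbra :: "'a::chilbert_space \<Rightarrow> 'a \<Rightarrow> 'a hs_op" is "\<lambda>u v x. cinner v x *\<^sub>C u"
  by (rule hilbert_schmidt_rank_one)

text \<open>Carrying the expansion of \<open>v\<close> through the bounded functional x \<mapsto>
  \<langle>u, A x\<rangle> gives, term by term, the series defining the scalar product; thereby the
  basis drops out.\<close>

lemma cinner_ketbra: "cinner (ketbra u v) A = cinner u (hs_apply A v)"
proof -
  have "bounded_linear (\<lambda>x. cinner u (hs_apply A x))"
    by (intro bounded_linear_compose[OF bounded_linear_cinner_right]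
        bounded_clinear_bounded_linear bounded_clinear_hs_apply)
  hence "((\<lambda>e. cinner u (hs_apply A (cinner e v *\<^sub>C e))) has_sum cinner u (hs_apply A v)) some_onb"
    by (rule has_sum_bounded_linear[OF _ orthonormal_basis_has_sum[OF orthonormal_basis_some_onb]])
  hence "((\<lambda>e. cinner (cinner v e *\<^sub>C u) (hs_apply A e)) has_sum cinner u (hs_apply A v)) some_onb"
    by (simp add: bounded_clinear_scaleC[OF bounded_clinear_hs_apply] cinner_scaleC_right
        cinner_scaleC_left flip: cinner_commute)
  thus ?thesis by (simp add: cinner_hs_op.rep_eq ketbra.rep_eq infsumI)
qed

lemma inner_zero_on_dense:
  assumes "closure (span X) = UNIV" "\<And>u. u \<in> X \<Longrightarrow> inner u w = 0"
  shows "w = (0::'a::real_inner)"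
proof -
  have "(\<lambda>u. inner u w) = (\<lambda>u. 0)"
    using assms by (intro bounded_linear_eq_on_dense[of _ _ X])
      (auto intro: bounded_linear_inner_left bounded_linear_zero)
  hence "inner w w = 0" by metis
  thus ?thesis by simp
qed

text \<open>An \<open>A\<close> orthogonal to all these operators has vanishing matrix elements
  between vectors of \<open>X\<close>. Density is used twice: first in \<open>u\<close>, giving
  \<open>A v = 0\<close> for \<open>v\<close> in \<open>X\<close>, then in \<open>v\<close>.\<close>

lemma closure_span_ketbra:
  fixes X :: "'a::chilbert_space set"
  assumes X: "closure (span X) = UNIV"
  shows "closure (span {ketbra u v |u v. u \<in> X \<and> v \<in> X}) = UNIV"
proof (rule ccontr)
  let ?M = "closure (span {ketbra u v |u v. u \<in> X \<and> v \<in> X})"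
  assume "?M \<noteq> UNIV"
  then obtain A where A: "A \<noteq> 0" "\<And>m. m \<in> ?M \<Longrightarrow> inner A m = 0"
    using ex_orthogonal_to_closed_subspace[of ?M] subspace_closure[OF subspace_span] by blast
  have 0: "inner u (hs_apply A v) = 0" if "u \<in> X" "v \<in> X" for u v
  proof -
    have "ketbra u v \<in> ?M"       by (intro subsetD[OF closure_subset] span_base) (use that in blast)
    hence "inner (ketbra u v) A = 0" by (subst inner_commute) (rule A(2))
    thus ?thesis by (simp add: inner_cinner cinner_ketbra)
  qed
  have "hs_apply A v = 0" if "v \<in> X" for v
    by (rule inner_zero_on_dense[OF X]) (rule 0[OF _ that])
  hence "hs_apply A = (\<lambda>x. 0)"
    by (intro bounded_linear_eq_on_dense[OF _ bounded_linear_zero _ X]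
        bounded_clinear_bounded_linear bounded_clinear_hs_apply)
  hence "A = 0" by (intro hs_op_eqI) (simp only: zero_hs_op.rep_eq)
  with A(1) show False ..
qed

lemma hs_apply_add: "hs_apply (A + B) x = hs_apply A x + hs_apply B x"
  by (simp add: plus_hs_op.rep_eq)

lemma hs_apply_scaleC: "hs_apply (c *\<^sub>C A) x = c *\<^sub>C hs_apply A x"
  by (simp add: scaleC_hs_op.rep_eq)

text \<open>
  With \<open>W = \<Sum>\<^sub>e |e\<rangle>\<langle>A\<^sup>*e|\<close> over finitely many basis vectors, \<open>\<parallel>W\<parallel>\<^sup>2\<close> and \<open>\<langle>W, A\<rangle>\<close> both equal
  \<open>\<Sum>\<^sub>e \<parallel>A\<^sup>*e\<parallel>\<^sup>2\<close>, so Cauchy-Schwarz gives \<open>\<parallel>W\<parallel> \<le> \<parallel>A\<parallel>\<close>.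
\<close>

lemma sum_norm_cadjoint_le:
  fixes A :: "'a::chilbert_space hs_op"
  assumes F: "finite F" "F \<subseteq> some_onb"
  shows "(\<Sum>e\<in>F. (norm (cadjoint (hs_apply A) e))\<^sup>2) \<le> (norm A)\<^sup>2"
proof -
  let ?a = "cadjoint (hs_apply A)"
  let ?s = "complex_of_real (\<Sum>e\<in>F. (norm (?a e))\<^sup>2)"
  define W where "W = (\<Sum>e\<in>F. ketbra e (?a e))"
  have on: "cinner e f = (if e = f then 1 else 0)" if "e \<in> F" "f \<in> F" for e f
    using orthonormal_basis_some_onb F that unfolding orthonormal_basis_def orthonormal_def by blast
  have "cinner W B = (\<Sum>e\<in>F. cinner e (hs_apply B (?a e)))" for B
  proof -
    have "cinner W B = cnj (\<Sum>e\<in>F. cinner B (ketbra e (?a e)))"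
      by (subst cinner_commute) (simp add: W_def cinner_sum_right)
    thus ?thesis by (simp add: cinner_ketbra flip: cinner_commute)
  qed
  note W = this
  have "cinner W A = ?s"
    by (simp add: W cinner_self flip: cinner_cadjoint_left[OF bounded_clinear_hs_apply])
  moreover have "cinner W W = ?s"
  proof -
    have "cinner e (hs_apply W (?a e)) = complex_of_real ((norm (?a e))\<^sup>2)" if e: "e \<in> F" for e
    proof -
      have "cinner e (hs_apply W (?a e)) = cinner (ketbra e (?a e)) W" by (simp add: cinner_ketbra)
      also have "\<dots> = (\<Sum>f\<in>F. cinner (?a f) (?a e) * cinner e f)"
        by (simp add: W_def cinner_sum_right cinner_ketbra ketbra.rep_eq cinner_scaleC_right)
      also have "\<dots> = (\<Sum>f\<in>F. if f = e then cinner (?a e) (?a e) else 0)"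
        using on[OF e] by (intro sum.cong) auto
      finally show ?thesis using F(1) e by (simp add: cinner_self)
    qed
    thus ?thesis by (simp add: W)
  qed
  ultimately have eq: "(norm W)\<^sup>2 = (\<Sum>e\<in>F. (norm (?a e))\<^sup>2)" "(norm W)\<^sup>2 = inner W A"
    by (simp_all add: inner_cinner power2_norm_eq_inner)
  have "norm W * norm W \<le> norm W * norm A"
    using norm_cauchy_schwarz[of W A] eq(2) by (simp add: power2_eq_square)
  hence "norm W \<le> norm A" by (cases "W = 0") (simp_all add: mult_le_cancel_left)
  thus ?thesis unfolding eq(1)[symmetric] by (intro power_mono) auto
qed

lemma preserves_hilbert_schmidt_cadjoint: "preserves_hilbert_schmidt cadjoint"
  unfolding preserves_hilbert_schmidt_def
proof (intro allI impI)
  fix T :: "'a \<Rightarrow> 'a" assume T: "hilbert_schmidt T"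
  define A where "A = Abs_hs_op T"
  have A: "hs_apply A = T" using T by (simp add: A_def Abs_hs_op_inverse)
  have "(\<lambda>e. (norm (cadjoint T e))\<^sup>2) summable_on some_onb"
  proof (rule nonneg_bdd_above_summable_on)
    show "bdd_above (sum (\<lambda>e. (norm (cadjoint T e))\<^sup>2) ` {F. F \<subseteq> some_onb \<and> finite F})"
      using sum_norm_cadjoint_le[of _ A] unfolding A by (auto simp: bdd_above_def)
  qed auto
  thus "hilbert_schmidt (cadjoint T)"
    unfolding hilbert_schmidt_def
    by (simp add: bounded_clinear_cadjoint hilbert_schmidt_bounded_clinear[OF T])
qed

abbreviation hs_adjoint :: "'a::chilbert_space hs_op \<Rightarrow> 'a hs_op" where
  "hs_adjoint \<equiv> hs_restrict cadjoint"

lemma hs_apply_hs_adjoint: "hs_apply (hs_adjoint A) = cadjoint (hs_apply A)"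
  by (rule hs_apply_hs_restrict[OF preserves_hilbert_schmidt_cadjoint])

lemma hs_adjoint_hs_adjoint: "hs_adjoint (hs_adjoint A) = A"
  by (rule hs_op_eqI) (simp add: hs_apply_hs_adjoint cadjoint_cadjoint bounded_clinear_hs_apply)

text \<open>One inequality suffices: applied to the adjoint as well, it turns around, since the
  adjoint is an involution.\<close>

lemma norm_hs_adjoint: "norm (hs_adjoint A) = norm A"
proof (rule antisym)
  have "norm (hs_adjoint A) \<le> norm A" for A :: "'a hs_op"
  proof (rule power2_le_imp_le)
    show "(norm (hs_adjoint A))\<^sup>2 \<le> (norm A)\<^sup>2"
      unfolding norm_hs_op_power2[of "hs_adjoint A"]
    proof (rule infsum_le_finite_sums)
      show "(\<lambda>e. (norm (hs_apply (hs_adjoint A) e))\<^sup>2) summable_on some_onb"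
        using hilbert_schmidt_hs_apply[of "hs_adjoint A"] by (simp add: hilbert_schmidt_def)
    qed (simp add: hs_apply_hs_adjoint sum_norm_cadjoint_le)
  qed simp
  from this[of A] this[of "hs_adjoint A"]
  show "norm (hs_adjoint A) \<le> norm A" "norm A \<le> norm (hs_adjoint A)"
    by (simp_all add: hs_adjoint_hs_adjoint)
qed

lemma bounded_antilinear_hs_adjoint: "bounded_antilinear hs_adjoint"
proof (rule bounded_antilinearI[where K = 1])
  note adj = cinner_cadjoint_right[OF bounded_clinear_hs_apply]
  show "hs_adjoint (A + B) = hs_adjoint A + hs_adjoint B" for A B :: "'a hs_op"
    by (rule hs_op_eqI, rule cinner_ext_right)
      (simp add: hs_apply_hs_adjoint hs_apply_add adj cinner_add_left cinner_add_right)
  show "hs_adjoint (c *\<^sub>C A) = cnj c *\<^sub>C hs_adjoint A" for c and A :: "'a hs_op"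
    by (rule hs_op_eqI, rule cinner_ext_right)
      (simp add: hs_apply_hs_adjoint hs_apply_scaleC adj cinner_scaleC_left cinner_scaleC_right)
qed (simp add: norm_hs_adjoint)

section \<open>Left and right multiplication\<close>

lemma preserves_hilbert_schmidt_compose_left:
  assumes B: "bounded_clinear B"
  shows "preserves_hilbert_schmidt ((\<circ>) B)"
  unfolding preserves_hilbert_schmidt_def
proof (intro allI impI)
  fix T :: "'a \<Rightarrow> 'a" assume T: "hilbert_schmidt T"
  obtain K where K: "\<And>x. norm (B x) \<le> norm x * K"
    using bounded_linear.bounded[OF bounded_clinear_bounded_linear[OF B]] by auto
  have "(\<lambda>e. (norm ((B \<circ> T) e))\<^sup>2) summable_on some_onb"
  proof (rule summable_on_comparison_test)
    show "(\<lambda>e. (norm (T e))\<^sup>2 * K\<^sup>2) summable_on some_onb"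
      using T by (intro summable_on_cmult_left) (simp add: hilbert_schmidt_def)
    show "(norm ((B \<circ> T) e))\<^sup>2 \<le> (norm (T e))\<^sup>2 * K\<^sup>2" for e
      using power_mono[OF K norm_ge_zero] by (simp add: power_mult_distrib[symmetric])
  qed simp
  thus "hilbert_schmidt (B \<circ> T)"
    unfolding hilbert_schmidt_def
    by (simp add: bounded_clinear_compose[OF B] hilbert_schmidt_bounded_clinear[OF T])
qed

lemma hs_apply_compose_left:
  "bounded_clinear B \<Longrightarrow> hs_apply (hs_restrict ((\<circ>) B) A) x = B (hs_apply A x)"
  by (simp add: hs_apply_hs_restrict preserves_hilbert_schmidt_compose_left)

lemma bounded_clinear_hs_compose_left:
  assumes B: "bounded_clinear B"
  shows "bounded_clinear (hs_restrict ((\<circ>) B))"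
proof -
  obtain K where K: "\<And>x. norm (B x) \<le> norm x * K" "K > 0"
    using bounded_linear.pos_bounded[OF bounded_clinear_bounded_linear[OF B]] by auto
  show ?thesis
  proof (rule bounded_clinearI)
    fix A
    have su: "(\<lambda>e. (norm (hs_apply A e))\<^sup>2) summable_on some_onb" for A :: "'a hs_op"
      using hilbert_schmidt_hs_apply[of A] by (simp add: hilbert_schmidt_def)
    have "(norm (hs_restrict ((\<circ>) B) A))\<^sup>2 \<le> (\<Sum>\<^sub>\<infinity>e\<in>some_onb. (norm (hs_apply A e))\<^sup>2 * K\<^sup>2)"
      unfolding norm_hs_op_power2
    proof (rule infsum_mono[OF su])
      show "(\<lambda>e. (norm (hs_apply A e))\<^sup>2 * K\<^sup>2) summable_on some_onb"
        by (rule summable_on_cmult_left[OF su])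
      show "(norm (hs_apply (hs_restrict ((\<circ>) B) A) e))\<^sup>2 \<le> (norm (hs_apply A e))\<^sup>2 * K\<^sup>2" for e
        using power_mono[OF K(1) norm_ge_zero]
        by (simp add: hs_apply_compose_left[OF B] power_mult_distrib[symmetric])
    qed
    also have "\<dots> = (norm A * K)\<^sup>2"
      unfolding power_mult_distrib norm_hs_op_power2 by (rule infsum_cmult_left[OF su])
    finally show "norm (hs_restrict ((\<circ>) B) A) \<le> norm A * K"
      by (rule power2_le_imp_le) (use K(2) in simp)
  qed (auto intro!: hs_op_eqI simp: hs_apply_compose_left[OF B] hs_apply_add hs_apply_scaleC
      bounded_clinear_scaleC[OF B] linear_add[OF bounded_clinear_linear[OF B]])
qed

lemma cadjoint_compose:
  fixes A B :: "'a::chilbert_space \<Rightarrow> 'a"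
  assumes "bounded_clinear A" "bounded_clinear B"
  shows "cadjoint (A \<circ> B) = cadjoint B \<circ> cadjoint A"
  by (rule cadjoint_unique) (simp add: cinner_cadjoint_left assms)

text \<open>Here \<open>B\<close> moves the basis vectors, so there is no termwise comparison as for
  left multiplication; taking adjoints turns one case into the other.\<close>

lemma hilbert_schmidt_compose_right:
  assumes B: "bounded_clinear B" and T: "hilbert_schmidt T"
  shows "hilbert_schmidt (T \<circ> B)"
proof -
  note bT = hilbert_schmidt_bounded_clinear[OF T]
  have "T \<circ> B = cadjoint (cadjoint B \<circ> cadjoint T)"
    by (metis B bT bounded_clinear_compose cadjoint_cadjoint cadjoint_compose)
  thus ?thesis
    using T preserves_hilbert_schmidt_compose_left[OF bounded_clinear_cadjoint[OF B]]
      preserves_hilbert_schmidt_cadjoint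
    by (auto simp: preserves_hilbert_schmidt_def)
qed

lemma preserves_hilbert_schmidt_compose_right:
  "bounded_clinear B \<Longrightarrow> preserves_hilbert_schmidt (\<lambda>T. T \<circ> B)"
  by (simp add: preserves_hilbert_schmidt_def hilbert_schmidt_compose_right)

lemma hs_apply_compose_right:
  "bounded_clinear B \<Longrightarrow> hs_apply (hs_restrict (\<lambda>T. T \<circ> B) A) x = hs_apply A (B x)"
  by (simp add: hs_apply_hs_restrict preserves_hilbert_schmidt_compose_right)

lemma hs_compose_right_eq:
  assumes B: "bounded_clinear B"
  shows "hs_restrict (\<lambda>T. T \<circ> B) =
    hs_adjoint \<circ> (hs_restrict ((\<circ>) (cadjoint B)) \<circ> hs_adjoint)"
proof (rule ext, rule hs_op_eqI, rule cinner_ext_right)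
  fix A x v
  note bA = bounded_clinear_hs_apply and bB = bounded_clinear_cadjoint[OF B]
  have "cinner v (hs_apply (hs_adjoint (hs_restrict ((\<circ>) (cadjoint B)) (hs_adjoint A))) x) =
      cinner (cadjoint B (cadjoint (hs_apply A) v)) x"
    by (simp add: hs_apply_hs_adjoint cinner_cadjoint_right[OF bA] hs_apply_compose_left[OF bB])
  thus "cinner v (hs_apply (hs_restrict (\<lambda>T. T \<circ> B) A) x) =
      cinner v (hs_apply ((hs_adjoint \<circ> (hs_restrict ((\<circ>) (cadjoint B)) \<circ> hs_adjoint)) A) x)"
    by (simp add: cinner_cadjoint_left[OF B] cinner_cadjoint_left[OF bA] hs_apply_compose_right[OF B])
qed

lemma bounded_clinear_hs_compose_right:
  assumes B: "bounded_clinear B"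
  shows "bounded_clinear (hs_restrict (\<lambda>T. T \<circ> B))"
  unfolding hs_compose_right_eq[OF B]
  by (intro bounded_antilinear_compose bounded_clinear_compose_antilinear
      bounded_antilinear_hs_adjoint bounded_clinear_hs_compose_left bounded_clinear_cadjoint B)

lemma positive_op_hs_compose_left:
  assumes P: "positive_op P"
  shows "positive_op (hs_restrict ((\<circ>) P))"
proof -
  note bP = positive_op_bounded_clinear[OF P]
  have "Im (cinner A (hs_restrict ((\<circ>) P) A)) = 0 \<and> 0 \<le> Re (cinner A (hs_restrict ((\<circ>) P) A))" for A
  proof -
    let ?B = "hs_restrict ((\<circ>) P) A"
    have su: "(\<lambda>e. cinner (hs_apply A e) (hs_apply ?B e)) summable_on some_onb"
      by (intro hilbert_schmidt_summable_cinner hilbert_schmidt_hs_apply)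
    have pos: "Im (cinner x (P x)) = 0" "0 \<le> Re (cinner x (P x))" for x
      using P by (auto simp: positive_op_def)
    show ?thesis
      unfolding cinner_hs_op.rep_eq infsum_Im[OF su, symmetric] infsum_Re[OF su, symmetric]
      by (auto simp: hs_apply_compose_left[OF bP] pos intro!: infsum_nonneg)
  qed
  thus ?thesis
    unfolding positive_op_def using bounded_clinear_hs_compose_left[OF bP] by blast
qed

lemma positive_op_cadjoint: "positive_op P \<Longrightarrow> cadjoint P = P"
  by (rule cadjoint_unique) (simp add: positive_op_symmetric)

text \<open>The adjoint map is antiunitary and conjugates right multiplication by \<open>P\<close>
  into left multiplication by \<open>P\<close>. It swaps the arguments of the scalar product, and
  symmetry of the left multiplication swaps them back.\<close>

lemma positive_op_hs_compose_right:
  assumes P: "positive_op (P :: 'a::chilbert_space \<Rightarrow> 'a)"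
  shows "positive_op (hs_restrict (\<lambda>T. T \<circ> P))"
proof -
  note bP = positive_op_bounded_clinear[OF P] and pL = positive_op_hs_compose_left[OF P]
  have "cinner A (hs_restrict (\<lambda>T. T \<circ> P) A) =
      cinner (hs_adjoint A) (hs_restrict ((\<circ>) P) (hs_adjoint A))" for A :: "'a hs_op"
  proof -
    have "cinner A (hs_restrict (\<lambda>T. T \<circ> P) A) =
        cinner (hs_adjoint (hs_adjoint A)) (hs_adjoint (hs_restrict ((\<circ>) P) (hs_adjoint A)))"
      by (simp add: hs_compose_right_eq[OF bP] positive_op_cadjoint[OF P] hs_adjoint_hs_adjoint)
    thus ?thesis
      by (simp add: antilinear_isometry_cinner[OF bounded_antilinear_hs_adjoint norm_hs_adjoint]
          positive_op_symmetric[OF pL])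
  qed
  thus ?thesis
    using pL bounded_clinear_hs_compose_right[OF bP] by (simp add: positive_op_def)
qed

section \<open>Operators on the tensor product\<close>

lemma hilbert_tensorD:
  assumes "hilbert_tensor tens"
  shows "tens (x + x') y = tens x y + tens x' y" "tens x (y + y') = tens x y + tens x y'"
    "tens (c *\<^sub>C x) y = c *\<^sub>C tens x y" "tens x (c *\<^sub>C y) = c *\<^sub>C tens x y"
    "cinner (tens x y) (tens x' y') = cinner x x' * cinner y y'"
    "closure (span {tens x y |x y. True}) = UNIV"
  using assms by (auto simp: hilbert_tensor_def)

text \<open>Lets constructions on the first factor serve for the second.\<close>

lemma hilbert_tensor_flip:
  assumes "hilbert_tensor tens"
  shows "hilbert_tensor (\<lambda>x y. tens y x)"
proof -
  have "{tens y x |x y. True} = {tens x y |x y. True}" by blast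
  thus ?thesis using hilbert_tensorD[OF assms] by (simp add: hilbert_tensor_def mult.commute)
qed

lemma has_sum_finite_sum:
  fixes f :: "'i \<Rightarrow> 'a \<Rightarrow> 'b::topological_comm_monoid_add"
  assumes "\<And>i. i \<in> I \<Longrightarrow> (f i has_sum s i) A"
  shows "((\<lambda>x. \<Sum>i\<in>I. f i x) has_sum (\<Sum>i\<in>I. s i)) A"
  using assms by (induction I rule: infinite_finite_induct) (auto intro: has_sum_add)

text \<open>
  The vector \<open>\<Sum>\<^sub>i \<langle>e, y\<^sub>i\<rangle> x\<^sub>i\<close> is the contraction of \<open>\<Sum>\<^sub>i x\<^sub>i \<otimes> y\<^sub>i\<close> with \<open>e\<close> in the second factor.
\<close>

lemma cinner_tensor_sum_has_sum:
  fixes tens :: "'a::chilbert_space \<Rightarrow> 'a \<Rightarrow> 'b::complex_inner"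
  assumes t: "hilbert_tensor tens"
  shows "((\<lambda>e. cinner (\<Sum>i\<in>I. cinner e (y i) *\<^sub>C x i) (\<Sum>i\<in>I. cinner e (y i) *\<^sub>C x' i)) has_sum
    cinner (\<Sum>i\<in>I. tens (x i) (y i)) (\<Sum>i\<in>I. tens (x' i) (y i))) some_onb"
proof -
  have "((\<lambda>e. cinner (cinner e (y i) *\<^sub>C x i) (cinner e (y j) *\<^sub>C x' j)) has_sum
      cinner (x i) (x' j) * cinner (y i) (y j)) some_onb" for i j
  proof -
    have "((\<lambda>e. cinner (y i) (cinner e (y j) *\<^sub>C e)) has_sum cinner (y i) (y j)) some_onb"
      by (rule has_sum_bounded_linear[OF bounded_linear_cinner_right
          orthonormal_basis_has_sum[OF orthonormal_basis_some_onb]])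
    hence "((\<lambda>e. cinner (x i) (x' j) * cinner (y i) (cinner e (y j) *\<^sub>C e)) has_sum
        cinner (x i) (x' j) * cinner (y i) (y j)) some_onb"
      by (rule has_sum_cmult_right)
    thus ?thesis
      by (simp add: cinner_scaleC_left cinner_scaleC_right mult_ac flip: cinner_commute)
  qed
  hence "((\<lambda>e. \<Sum>i\<in>I. \<Sum>j\<in>I. cinner (cinner e (y i) *\<^sub>C x i) (cinner e (y j) *\<^sub>C x' j)) has_sum
      (\<Sum>i\<in>I. \<Sum>j\<in>I. cinner (x i) (x' j) * cinner (y i) (y j))) some_onb"
    by (intro has_sum_finite_sum)
  thus ?thesis
    unfolding cinner_sum_left unfolding cinner_sum_right by (simp add: hilbert_tensorD[OF t])
qed

text \<open>Both components share one family of vectors, which makes their contractions comparable;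
  real coefficients are absorbed into the first factor.\<close>

lemma span_tensor_pairs:
  fixes tens :: "'a::complex_inner \<Rightarrow> 'a \<Rightarrow> 'b::complex_inner" and A :: "'a \<Rightarrow> 'a"
  assumes t: "hilbert_tensor tens" and A: "bounded_clinear A"
    and p: "p \<in> span {(tens x y, tens (A x) y) |x y. True}"
  shows "\<exists>n x y. p = ((\<Sum>i<n::nat. tens (x i) (y i)), (\<Sum>i<n. tens (A (x i)) (y i)))"
  using p
proof (induction rule: span_induct_alt)
  case base
  show ?case by (intro exI[of _ 0]) (simp add: zero_prod_def)
next
  case (step c b p)
  then obtain x y n xs ys where b: "b = (tens x y, tens (A x) y)"
    and p: "p = ((\<Sum>i<n::nat. tens (xs i) (ys i)), (\<Sum>i<n. tens (A (xs i)) (ys i)))"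
    by blast
  have "c *\<^sub>R b = (tens (c *\<^sub>R x) y, tens (A (c *\<^sub>R x)) y)"
    by (simp add: b scaleR_scaleC hilbert_tensorD[OF t] bounded_clinear_scaleC[OF A])
  thus ?case
    by (intro exI[of _ "Suc n"] exI[of _ "xs(n := c *\<^sub>R x)"] exI[of _ "ys(n := y)"])
      (simp add: p add.commute)
qed

text \<open>Contracting the second factor with a basis vector \<open>e\<close> turns a sum of
  tensors into a vector \<open>?c e\<close>, and its image into \<open>A (?c e)\<close>. Summing the
  squared norms over \<open>e\<close> transfers the bound of \<open>A\<close> to the tensor
  product.\<close>

lemma ex_tensor_left:
  fixes tens :: "'a::chilbert_space \<Rightarrow> 'a \<Rightarrow> 'b::chilbert_space"
  assumes t: "hilbert_tensor tens" and A: "bounded_clinear A"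
  shows "\<exists>R. bounded_clinear R \<and> (\<forall>x y. R (tens x y) = tens (A x) y)"
proof -
  let ?X = "{(tens x y, tens (A x) y) |x y. True}"
  note lA = bounded_clinear_linear[OF A]
  obtain K where K: "\<And>x. norm (A x) \<le> norm x * K" "K > 0"
    using bounded_linear.pos_bounded[OF bounded_clinear_bounded_linear[OF A]] by auto
  have "\<exists>R. bounded_clinear R \<and> (\<forall>x. norm (R x) \<le> norm x * K) \<and> (\<forall>x y. (x, y) \<in> span ?X \<longrightarrow> R x = y)"
  proof (rule bounded_clinear_extension)
    show "(c *\<^sub>C u, c *\<^sub>C w) \<in> span ?X" if "(u, w) \<in> span ?X" for c u w
    proof (rule span_scaleC_closed[OF _ that])
      fix u w assume "(u, w) \<in> ?X"
      then obtain x y where "u = tens x y" "w = tens (A x) y" by blast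
      thus "(c *\<^sub>C u, c *\<^sub>C w) \<in> ?X"
        by (auto simp: hilbert_tensorD[OF t, symmetric] bounded_clinear_scaleC[OF A, symmetric])
    qed
    show "norm w \<le> norm u * K" if uw: "(u, w) \<in> span ?X" for u w
    proof -
      obtain n x y where u: "u = (\<Sum>i<n::nat. tens (x i) (y i))"
        and w: "w = (\<Sum>i<n. tens (A (x i)) (y i))"
        using span_tensor_pairs[OF t A uw] by auto
      let ?c = "\<lambda>e. \<Sum>i<n. cinner e (y i) *\<^sub>C x i"
      have Ac: "(\<Sum>i<n. cinner e (y i) *\<^sub>C A (x i)) = A (?c e)" for e
        by (simp add: linear_sum[OF lA] bounded_clinear_scaleC[OF A])
      have sq: "Re (cinner v v) = (norm v)\<^sup>2" for v :: "'c::complex_inner" by (simp add: cinner_self)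
      note hs = cinner_tensor_sum_has_sum[OF t, THEN has_sum_Re, of y _ "{..<n}"]
      have "((\<lambda>e. (norm (A (?c e)))\<^sup>2) has_sum (norm w)\<^sup>2) some_onb"
        using hs[of "\<lambda>i. A (x i)" "\<lambda>i. A (x i)"] unfolding Ac w[symmetric] sq .
      moreover have "((\<lambda>e. (norm (?c e))\<^sup>2 * K\<^sup>2) has_sum (norm u)\<^sup>2 * K\<^sup>2) some_onb"
        using hs[of x x] unfolding u[symmetric] sq by (rule has_sum_cmult_left)
      ultimately have "(norm w)\<^sup>2 \<le> (norm u)\<^sup>2 * K\<^sup>2"
        by (rule has_sum_mono) (use power_mono[OF K(1) norm_ge_zero] in
            \<open>simp add: power_mult_distrib[symmetric]\<close>)
      thus ?thesis
        unfolding power_mult_distrib[symmetric]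
        by (rule power2_le_imp_le) (use K(2) in simp)
    qed
    have "fst ` ?X = {tens x y |x y. True}" by force
    thus "closure (fst ` span ?X) = UNIV"
      by (simp only: span_fst hilbert_tensorD(6)[OF t])
  qed (rule subspace_span)
  then obtain R where R: "bounded_clinear R" "\<forall>x y. (x, y) \<in> span ?X \<longrightarrow> R x = y" by blast
  have "R (tens x y) = tens (A x) y" for x y
  proof -
    have "(tens x y, tens (A x) y) \<in> span ?X" by (rule span_base) blast
    thus ?thesis using R(2) by blast
  qed
  with R(1) show ?thesis by blast
qed

lemma hilbert_tensor_operator_eqI:
  assumes t: "hilbert_tensor tens" and f: "bounded_linear f" and g: "bounded_linear g"
    and eq: "\<And>x y. f (tens x y) = g (tens x y)"
  shows "f = g"
  by (rule bounded_linear_eq_on_dense[OF f g _ hilbert_tensorD(6)[OF t]]) (use eq in auto)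

lemma tensor_op:
  fixes tens :: "'a::chilbert_space \<Rightarrow> 'a \<Rightarrow> 'b::chilbert_space"
  assumes t: "hilbert_tensor tens" and A: "bounded_clinear A" and B: "bounded_clinear B"
  shows "bounded_clinear (tensor_op tens A B)" "tensor_op tens A B (tens x y) = tens (A x) (B y)"
proof -
  obtain R where R: "bounded_clinear R" "\<And>x y. R (tens x y) = tens (A x) y"
    using ex_tensor_left[OF t A] by blast
  obtain Q where Q: "bounded_clinear Q" "\<And>x y. Q (tens x y) = tens x (B y)"
    using ex_tensor_left[OF hilbert_tensor_flip[OF t] B] by blast
  let ?P = "\<lambda>R. bounded_clinear R \<and> (\<forall>x y. R (tens x y) = tens (A x) (B y))"
  have "?P (tensor_op tens A B)"
    unfolding tensor_op_def
  proof (rule theI[of ?P])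
    show "?P (R \<circ> Q)" by (simp add: bounded_clinear_compose R Q)
    show "R' = R \<circ> Q" if "?P R'" for R'
      using that by (intro hilbert_tensor_operator_eqI[OF t] bounded_clinear_bounded_linear
          bounded_clinear_compose) (auto simp: R Q)
  qed
  thus "bounded_clinear (tensor_op tens A B)" "tensor_op tens A B (tens x y) = tens (A x) (B y)"
    by auto
qed

lemma tensor_op_flip: "tensor_op tens A B = tensor_op (\<lambda>x y. tens y x) B A"
  unfolding tensor_op_def by (rule arg_cong[where f = The]) blast

text \<open>On the span of the simple tensors the quadratic form is the sum over \<open>e\<close> of
  the forms of \<open>P\<close> at the contractions \<open>?c e\<close>. Continuity then carries
  positivity to the closure.\<close>

lemma positive_op_tensor_left:
  fixes tens :: "'a::chilbert_space \<Rightarrow> 'a \<Rightarrow> 'b::chilbert_space"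
  assumes t: "hilbert_tensor tens" and P: "positive_op P"
  shows "positive_op (tensor_op tens P id)"
proof -
  note bP = positive_op_bounded_clinear[OF P]
  note R = tensor_op[OF t bP bounded_clinear_id]
  let ?R = "tensor_op tens P id"
  let ?X = "{(tens x y, tens (P x) y) |x y. True}" and ?T = "{tens x y |x y. True}"
  note cont = linear_continuous_on[OF bounded_clinear_bounded_linear[OF R(1)]]
  \<comment> \<open>Written with real inner products, an imaginary part being one with \<i> on the
    left argument, the conditions are visibly closed.\<close>
  have cl: "closed {u. Im (cinner u (?R u)) = 0 \<and> 0 \<le> Re (cinner u (?R u))}"
    unfolding Im_cinner inner_cinner[symmetric]
    by (intro closed_Collect_conj closed_Collect_eq closed_Collect_le continuous_on_inner
        continuous_on_const continuous_on_id cont linear_continuous_on bounded_linear_scaleC_right)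
  have "span ?T \<subseteq> {u. Im (cinner u (?R u)) = 0 \<and> 0 \<le> Re (cinner u (?R u))}"
  proof
    fix u assume "u \<in> span ?T"
    also have "?T = fst ` ?X" by force
    finally obtain w where uw: "(u, w) \<in> span ?X" by (auto simp flip: span_fst)
    obtain n x y where u: "u = (\<Sum>i<n::nat. tens (x i) (y i))"
      and w: "w = (\<Sum>i<n. tens (P (x i)) (y i))"
      using span_tensor_pairs[OF t bP uw] by auto
    have Ru: "?R u = w"
      by (simp add: u w linear_sum[OF bounded_clinear_linear[OF R(1)]] R(2))
    let ?c = "\<lambda>e. \<Sum>i<n. cinner e (y i) *\<^sub>C x i"
    have Pc: "(\<Sum>i<n. cinner e (y i) *\<^sub>C P (x i)) = P (?c e)" for e
      by (simp add: linear_sum[OF bounded_clinear_linear[OF bP]] bounded_clinear_scaleC[OF bP])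
    have hs: "((\<lambda>e. cinner (?c e) (P (?c e))) has_sum cinner u (?R u)) some_onb"
      using cinner_tensor_sum_has_sum[OF t, of y x "{..<n}" "\<lambda>i. P (x i)"]
      unfolding Pc Ru by (simp add: u w)
    have pos: "Im (cinner x (P x)) = 0" "0 \<le> Re (cinner x (P x))" for x
      using P by (auto simp: positive_op_def)
    have "Im (cinner u (?R u)) = 0"
      using has_sum_Im[OF hs] by (simp add: pos has_sum_iff)
    moreover have "0 \<le> Re (cinner u (?R u))"
      by (rule has_sum_nonneg[OF has_sum_Re[OF hs]]) (rule pos)
    ultimately show "u \<in> {u. Im (cinner u (?R u)) = 0 \<and> 0 \<le> Re (cinner u (?R u))}" by simp
  qed
  from closure_minimal[OF this cl] show ?thesis
    unfolding hilbert_tensorD(6)[OF t] positive_op_def using R(1) by auto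
qed

lemma positive_op_tensor_right:
  fixes tens :: "'a::chilbert_space \<Rightarrow> 'a \<Rightarrow> 'b::chilbert_space"
  assumes "hilbert_tensor tens" "positive_op P"
  shows "positive_op (tensor_op tens id P)"
  unfolding tensor_op_flip[of tens id P]
  by (rule positive_op_tensor_left[OF hilbert_tensor_flip[OF assms(1)] assms(2)])

section \<open>Crossing of Hilbert-Schmidt operators\<close>

text \<open>Equal Gram matrices on the generators extend to the span by linearity, in one argument
  first and then in the other. This gives the norm estimate without choosing representations of the
  elements.\<close>

lemma span_isometric_pairs:
  fixes X :: "('a::real_inner \<times> 'b::real_inner) set"
  assumes X: "\<And>p q. p \<in> X \<Longrightarrow> q \<in> X \<Longrightarrow> inner (fst p) (fst q) = inner (snd p) (snd q)"
    and p: "p \<in> span X"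
  shows "norm (fst p) = norm (snd p)"
proof -
  have sub: "subspace {p::'a \<times> 'b. inner (fst p) (fst q) = inner (snd p) (snd q)}" for q
    by (simp add: subspace_def inner_add_left)
  have 1: "span X \<subseteq> {p. inner (fst p) (fst q) = inner (snd p) (snd q)}" if "q \<in> X" for q
    using X that by (intro span_minimal sub) auto
  have "X \<subseteq> {q. inner (fst q) (fst p) = inner (snd q) (snd p)}"
    using 1 p by (auto simp: inner_commute)
  hence "span X \<subseteq> {q. inner (fst q) (fst p) = inner (snd q) (snd p)}"
    by (intro span_minimal sub)
  thus ?thesis using p by (auto simp: norm_eq_sqrt_inner)
qed

lemma ketbra_scaleC_left: "ketbra (c *\<^sub>C u) v = c *\<^sub>C ketbra u v"
  by (rule hs_op_eqI) (simp add: ketbra.rep_eq hs_apply_scaleC scaleC_scaleC mult.commute)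

text \<open>
  The crossing map for an antiunitary involution is the adjoint of the isometry
  \<open>|a \<otimes> b\<rangle>\<langle>c \<otimes> d| \<mapsto> |b \<otimes> J d\<rangle>\<langle>J a \<otimes> c|\<close>, because \<open>\<langle>u, A v\<rangle>\<close> is the scalar product of
  \<open>|u\<rangle>\<langle>v|\<close> with \<open>A\<close>.
\<close>

lemma ex_crossing_antiunitary:
  fixes tens :: "'a::chilbert_space \<Rightarrow> 'a \<Rightarrow> 'b::chilbert_space"
  assumes t: "hilbert_tensor tens" and J: "bounded_antilinear_involution J"
    and n: "\<And>x. norm (J x) = norm x"
  shows "\<exists>C. bounded_clinear C \<and> (\<forall>A. norm (C A) \<le> norm A) \<and>
    (\<forall>A. is_crossing tens J (hs_apply A) (hs_apply (C A)))"
proof -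
  let ?X = "{(ketbra (tens a b) (tens c d), ketbra (tens b (J d)) (tens (J a) c)) |a b c d. True}"
  have anti: "bounded_antilinear J" using J by (simp add: bounded_antilinear_involution_def)
  note cJ = antilinear_isometry_cinner[OF anti n]
  have "\<exists>V. bounded_clinear V \<and> (\<forall>x. norm (V x) \<le> norm x * 1) \<and> (\<forall>x y. (x, y) \<in> span ?X \<longrightarrow> V x = y)"
  proof (rule bounded_clinear_extension)
    show "(r *\<^sub>C A, r *\<^sub>C B) \<in> span ?X" if "(A, B) \<in> span ?X" for r A B
    proof (rule span_scaleC_closed[OF _ that])
      fix A B assume "(A, B) \<in> ?X"
      then obtain a b c d where "A = ketbra (tens a b) (tens c d)"
        "B = ketbra (tens b (J d)) (tens (J a) c)" by blast
      hence "r *\<^sub>C A = ketbra (tens a (r *\<^sub>C b)) (tens c d)"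
        "r *\<^sub>C B = ketbra (tens (r *\<^sub>C b) (J d)) (tens (J a) c)"
        by (simp_all add: ketbra_scaleC_left hilbert_tensorD[OF t])
      thus "(r *\<^sub>C A, r *\<^sub>C B) \<in> ?X" by blast
    qed
    show "norm B \<le> norm A * 1" if "(A, B) \<in> span ?X" for A B
    proof -
      have "norm (fst (A, B)) = norm (snd (A, B))"
      proof (rule span_isometric_pairs[OF _ that])
        fix p q assume "p \<in> ?X" "q \<in> ?X"
        then obtain a b c d a' b' c' d'
          where p: "p = (ketbra (tens a b) (tens c d), ketbra (tens b (J d)) (tens (J a) c))"
            and q: "q = (ketbra (tens a' b') (tens c' d'), ketbra (tens b' (J d')) (tens (J a') c'))"
          by blast
        \<comment> \<open>Both sides are products of the same four scalar products: a pair that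
          moves between ket and bra would have its arguments exchanged, and the isometry
          \<open>J\<close> exchanges them back.\<close>
        show "inner (fst p) (fst q) = inner (snd p) (snd q)"
          unfolding p q inner_cinner
          by (simp add: cinner_ketbra ketbra.rep_eq cinner_scaleC_right hilbert_tensorD[OF t] cJ mult_ac)
      qed
      thus ?thesis by simp
    qed
    have "fst ` ?X = {ketbra u v |u v. u \<in> {tens x y |x y. True} \<and> v \<in> {tens x y |x y. True}}"
      by (auto simp: image_iff) blast+
    thus "closure (fst ` span ?X) = UNIV"
      by (simp only: span_fst closure_span_ketbra[OF hilbert_tensorD(6)[OF t]])
  qed (rule subspace_span)
  then obtain V where V: "bounded_clinear V" "\<And>x. norm (V x) \<le> norm x * 1"
    and VX: "\<forall>x y. (x, y) \<in> span ?X \<longrightarrow> V x = y" by blast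
  have Vk: "V (ketbra (tens a b) (tens c d)) = ketbra (tens b (J d)) (tens (J a) c)" for a b c d
  proof -
    have "(ketbra (tens a b) (tens c d), ketbra (tens b (J d)) (tens (J a) c)) \<in> span ?X"
      by (rule span_base) blast
    thus ?thesis using VX by blast
  qed
  have "is_crossing tens J (hs_apply A) (hs_apply (cadjoint V A))" for A
    unfolding is_crossing_def antiunitary_involution_adjoint[OF J n]
    by (simp add: bounded_clinear_hs_apply cinner_cadjoint_right[OF V(1)] Vk
        flip: cinner_ketbra)
  moreover have "norm (cadjoint V A) \<le> norm A" for A
    using norm_cadjoint_le[OF V] by simp
  ultimately show ?thesis using bounded_clinear_cadjoint[OF V(1)] by blast
qed

lemma is_crossing_unique:
  assumes t: "hilbert_tensor tens" and "is_crossing tens S T R" "is_crossing tens S T R'"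
  shows "R = R'"
proof (rule hilbert_tensor_operator_eqI[OF t])
  fix \<psi>\<^sub>1 \<psi>\<^sub>2
  have "cinner (tens \<phi>\<^sub>1 \<phi>\<^sub>2) (R (tens \<psi>\<^sub>1 \<psi>\<^sub>2) - R' (tens \<psi>\<^sub>1 \<psi>\<^sub>2)) = 0" for \<phi>\<^sub>1 \<phi>\<^sub>2
    using assms unfolding is_crossing_def cinner_diff_right by (metis diff_self)
  hence "R (tens \<psi>\<^sub>1 \<psi>\<^sub>2) - R' (tens \<psi>\<^sub>1 \<psi>\<^sub>2) = 0"
    by (intro inner_zero_on_dense[OF hilbert_tensorD(6)[OF t]]) (auto simp: inner_cinner)
  thus "R (tens \<psi>\<^sub>1 \<psi>\<^sub>2) = R' (tens \<psi>\<^sub>1 \<psi>\<^sub>2)" by simp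
qed (use assms in \<open>auto simp: is_crossing_def bounded_clinear_bounded_linear\<close>)

lemma crossing_eqI:
  assumes "hilbert_tensor tens" "is_crossing tens S T R"
  shows "crossing tens S T = R"
  unfolding crossing_def
  by (rule the_equality) (use assms is_crossing_unique in blast)+

text \<open>The involution enters the crossing identity only through the two vectors on the side of
  \<open>T\<close>. \<open>Q\<close> corrects the right one, and \<open>L\<close>, through its
  adjoint, the left one.\<close>

lemma is_crossing_change_involution:
  fixes tens :: "'a::chilbert_space \<Rightarrow> 'a \<Rightarrow> 'b::chilbert_space"
  assumes L: "bounded_clinear L"
    and L_tens: "\<And>x y. cadjoint L (tens x (antilinear_adjoint J y)) = tens x (antilinear_adjoint S y)"
    and Q_tens: "\<And>x y. Q (tens (J x) y) = tens (S x) y"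
    and R: "is_crossing tens J (L \<circ> T \<circ> Q) R"
  shows "is_crossing tens S T R"
  using R unfolding is_crossing_def
  by (simp add: Q_tens L_tens flip: cinner_cadjoint_left[OF L])

text \<open>Composing either \<open>S\<close> or its adjoint with \<open>J\<close> gives a linear
  operator, which can be placed in one tensor factor. \<open>L\<close> is introduced as an adjoint
  because its own adjoint is what acts on the left vector.\<close>

lemma ex_crossing_involution:
  fixes tens :: "'a::chilbert_space \<Rightarrow> 'a \<Rightarrow> 'b::chilbert_space" and S J :: "'a \<Rightarrow> 'a"
  assumes t: "hilbert_tensor tens" and J: "bounded_antilinear_involution J"
    and n: "\<And>x. norm (J x) = norm x" and S: "bounded_antilinear_involution S"
  shows "\<exists>C. bounded_clinear C \<and> (\<forall>A. is_crossing tens S (hs_apply A) (hs_apply (C A)))"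
proof -
  obtain C where C: "bounded_clinear C" "\<And>A. is_crossing tens J (hs_apply A) (hs_apply (C A))"
    using ex_crossing_antiunitary[OF t J n] by blast
  have bJ: "bounded_antilinear J" and JJ: "\<And>x. J (J x) = x" and bS: "bounded_antilinear S"
    using J S by (auto simp: bounded_antilinear_involution_def)
  note adjJ = antiunitary_involution_adjoint[OF J n]
  note B = bounded_antilinear_compose[OF bounded_antilinear_antilinear_adjoint[OF bS] bJ]
  note right = tensor_op[OF t bounded_clinear_id B]
  note left = tensor_op[OF t bounded_antilinear_compose[OF bS bJ] bounded_clinear_id]
  define L where "L = cadjoint (tensor_op tens id (antilinear_adjoint S \<circ> J))"
  define Q where "Q = tensor_op tens (S \<circ> J) id"
  have L: "bounded_clinear L" unfolding L_def by (rule bounded_clinear_cadjoint[OF right(1)])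
  have Q: "bounded_clinear Q" unfolding Q_def by (rule left(1))
  define C' where "C' = C \<circ> (hs_restrict ((\<circ>) L) \<circ> hs_restrict (\<lambda>T. T \<circ> Q))"
  have "bounded_clinear C'"
    unfolding C'_def by (intro bounded_clinear_compose C bounded_clinear_hs_compose_left
        bounded_clinear_hs_compose_right L Q)
  moreover have "is_crossing tens S (hs_apply A) (hs_apply (C' A))" for A
  proof (rule is_crossing_change_involution[OF L])
    show "cadjoint L (tens x (antilinear_adjoint J y)) = tens x (antilinear_adjoint S y)" for x y
      by (simp add: L_def cadjoint_cadjoint[OF right(1)] right(2) adjJ JJ)
    show "Q (tens (J x) y) = tens (S x) y" for x y
      by (simp add: Q_def left(2) JJ)
    have "L \<circ> hs_apply A \<circ> Q =
        hs_apply (hs_restrict ((\<circ>) L) (hs_restrict (\<lambda>T. T \<circ> Q) A))"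
      by (rule ext) (simp add: hs_apply_compose_left[OF L] hs_apply_compose_right[OF Q])
    thus "is_crossing tens J (L \<circ> hs_apply A \<circ> Q) (hs_apply (C' A))"
      using C(2) by (simp add: C'_def)
  qed
  ultimately show ?thesis by blast
qed

text \<open>Insert arguments already carrying \<open>S\<close> and its adjoint into the crossing
  identity of \<open>T\<close>: on the side of \<open>T\<close> both involutions cancel. The complex
  conjugate is the same identity with \<open>R\<close> and \<open>T\<close> exchanged and replaced
  by their adjoints.\<close>

lemma is_crossing_cadjoint:
  fixes tens :: "'a::chilbert_space \<Rightarrow> 'a \<Rightarrow> 'b::chilbert_space"
  assumes S: "bounded_antilinear_involution S" and T: "bounded_clinear T"
    and R: "is_crossing tens S T R"
  shows "is_crossing tens S (cadjoint R) (cadjoint T)"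
  unfolding is_crossing_def
proof (intro conjI allI bounded_clinear_cadjoint T)
  fix \<phi>\<^sub>1 \<phi>\<^sub>2 \<psi>\<^sub>1 \<psi>\<^sub>2
  let ?a = "antilinear_adjoint S"
  have bR: "bounded_clinear R"
    and cr: "cinner (tens y (?a d)) (T (tens (S x) c)) = cinner (tens x y) (R (tens c d))" for x y c d
    using R by (auto simp: is_crossing_def)
  have "cinner (tens \<phi>\<^sub>2 (?a \<psi>\<^sub>2)) (cadjoint R (tens (S \<phi>\<^sub>1) \<psi>\<^sub>1)) =
      cnj (cinner (tens (S \<phi>\<^sub>1) \<psi>\<^sub>1) (R (tens \<phi>\<^sub>2 (?a \<psi>\<^sub>2))))"
    by (simp add: cinner_cadjoint_right[OF bR] flip: cinner_commute)
  also have "\<dots> = cnj (cinner (tens \<psi>\<^sub>1 \<psi>\<^sub>2) (T (tens \<phi>\<^sub>1 \<phi>\<^sub>2)))"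
    using cr[of \<psi>\<^sub>1 "?a \<psi>\<^sub>2" "S \<phi>\<^sub>1" \<phi>\<^sub>2] S
    by (simp add: antilinear_adjoint_involution[OF S] bounded_antilinear_involution_def)
  also have "\<dots> = cinner (tens \<phi>\<^sub>1 \<phi>\<^sub>2) (cadjoint T (tens \<psi>\<^sub>1 \<psi>\<^sub>2))"
    by (simp add: cinner_cadjoint_right[OF T] flip: cinner_commute)
  finally show "cinner (tens \<phi>\<^sub>2 (?a \<psi>\<^sub>2)) (cadjoint R (tens (S \<phi>\<^sub>1) \<psi>\<^sub>1)) =
      cinner (tens \<phi>\<^sub>1 \<phi>\<^sub>2) (cadjoint T (tens \<psi>\<^sub>1 \<psi>\<^sub>2))" .
qed

lemma hilbert_schmidt_cases:
  assumes "hilbert_schmidt T" obtains A where "T = hs_apply A"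
  using assms Abs_hs_op_inverse by (metis mem_Collect_eq)

text \<open>Passes from a map \<open>C\<close> on the Hilbert space \<open>hs_op\<close>, where
  boundedness makes sense, to the crossing defined on all functions by definite description.\<close>

lemma hs_crossing:
  fixes tens :: "'a::chilbert_space \<Rightarrow> 'a \<Rightarrow> 'b::chilbert_space"
  assumes t: "hilbert_tensor tens"
    and C: "\<And>A. is_crossing tens S (hs_apply A) (hs_apply (C A))"
  shows "hilbert_schmidt T \<Longrightarrow> crossable tens S T"
    "preserves_hilbert_schmidt (crossing tens S)" "hs_restrict (crossing tens S) = C"
    "preserves_hilbert_schmidt (hat tens S)" "hs_restrict (hat tens S) = hs_adjoint \<circ> C"
proof -
  show "crossable tens S T" if T: "hilbert_schmidt T"
    unfolding crossable_def
    using hilbert_schmidt_bounded_clinear[OF T] hilbert_schmidt_cases[OF T] C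
      is_crossing_unique[OF t] by metis
  have cr: "crossing tens S (hs_apply A) = hs_apply (C A)" for A
    by (rule crossing_eqI[OF t C])
  show "preserves_hilbert_schmidt (crossing tens S)"
    unfolding preserves_hilbert_schmidt_def
    by (metis cr hilbert_schmidt_cases hilbert_schmidt_hs_apply)
  show "hs_restrict (crossing tens S) = C"
    by (rule ext) (simp add: hs_restrict_def cr hs_apply_inverse)
  have hat: "hat tens S (hs_apply A) = hs_apply (hs_adjoint (C A))" for A
    by (simp add: hat_def cr hs_apply_hs_adjoint)
  show "preserves_hilbert_schmidt (hat tens S)"
    unfolding preserves_hilbert_schmidt_def
    by (metis hat hilbert_schmidt_cases hilbert_schmidt_hs_apply)
  show "hs_restrict (hat tens S) = hs_adjoint \<circ> C"
    by (rule ext) (simp add: hs_restrict_def[of "hat tens S"] hat hs_apply_inverse)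
qed

lemma bounded_antilinear_involution_hs_hat:
  fixes tens :: "'a::chilbert_space \<Rightarrow> 'a \<Rightarrow> 'b::chilbert_space"
  assumes t: "hilbert_tensor tens" and S: "bounded_antilinear_involution S"
    and bC: "bounded_clinear C" and C: "\<And>A. is_crossing tens S (hs_apply A) (hs_apply (C A))"
  shows "bounded_antilinear_involution (hs_adjoint \<circ> C)"
proof -
  have "C (hs_adjoint (C A)) = hs_adjoint A" for A
  proof (rule hs_op_eqI)
    have "hs_apply (C (hs_adjoint (C A))) = cadjoint (hs_apply A)"
    proof (rule is_crossing_unique[OF t C])
      show "is_crossing tens S (hs_apply (hs_adjoint (C A))) (cadjoint (hs_apply A))"
        unfolding hs_apply_hs_adjoint
        by (rule is_crossing_cadjoint[OF S bounded_clinear_hs_apply C])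
    qed
    thus "hs_apply (C (hs_adjoint (C A))) x = hs_apply (hs_adjoint A) x" for x
      by (simp add: hs_apply_hs_adjoint)
  qed
  thus ?thesis
    using bounded_antilinear_compose_clinear[OF bounded_antilinear_hs_adjoint bC]
    by (simp add: bounded_antilinear_involution_def hs_adjoint_hs_adjoint)
qed

lemma bij_of_hs_adjoint_involution:
  assumes "bounded_antilinear_involution (hs_adjoint \<circ> C)"
  shows "bij C"
proof -
  have "C = hs_adjoint \<circ> (hs_adjoint \<circ> C)" by (rule ext) (simp add: hs_adjoint_hs_adjoint)
  moreover have "bij (hs_adjoint \<circ> C)" "bij (hs_adjoint :: 'a hs_op \<Rightarrow> _)"
    using assms by (auto intro!: involuntory_imp_bij
        simp: bounded_antilinear_involution_def hs_adjoint_hs_adjoint)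
  ultimately show ?thesis by (metis bij_comp)
qed

theorem proposition3p7:
  fixes tens :: "'a::chilbert_space \<Rightarrow> 'a \<Rightarrow> 'b::chilbert_space"
    and S J \<Delta> :: "'a \<Rightarrow> 'a"
  assumes separable: "separable_space (euclidean :: 'a topology)"
    and tensor: "hilbert_tensor tens"
    and S: "bounded_antilinear_involution S"
    and \<Delta>: "positive_op \<Delta>"
    and polar: "antilinear_polar_decomposition S J (op_sqrt \<Delta>)"
  shows
    "(\<forall>T. hilbert_schmidt T \<longrightarrow>
        (\<forall>S'. bounded_antilinear_involution S' \<longrightarrow> crossable tens S' T))
     \<and> {T. hilbert_schmidt T} \<subseteq> crossable_ops tens
     \<and> preserves_hilbert_schmidt (crossing tens J)
     \<and> unitary (hs_restrict (crossing tens J))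
     \<and> preserves_hilbert_schmidt (crossing tens S)
     \<and> bounded_clinear (hs_restrict (crossing tens S))
     \<and> bij (hs_restrict (crossing tens S))
     \<and> preserves_hilbert_schmidt (hat tens S)
     \<and> preserves_hilbert_schmidt (hat tens J)
     \<and> preserves_hilbert_schmidt (hat_Delta_half tens \<Delta>)
     \<and> antilinear_polar_decomposition (hs_restrict (hat tens S))
          (hs_restrict (hat tens J)) (hs_restrict (hat_Delta_half tens \<Delta>))
     \<and> standard_subspace {A. hs_apply A \<in> hat_H tens S}
     \<and> tomita_graph {A. hs_apply A \<in> hat_H tens S} = {(A, hs_restrict (hat tens S) A) |A. True}"
proof -

  \<comment> \<open>Consequences of the polar decomposition\<close>
  define D where "D = op_sqrt \<Delta>"
  have pol: "antilinear_polar_decomposition S J D" using polar by (simp add: D_def)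
  note inv_polar = involution_polar_decomposition[OF S pol]
  note J = inv_polar(1) and nJ = inv_polar(2)
  have D: "positive_op D" and SJD: "\<And>x. S x = J (D x)"
    using pol by (auto simp: antilinear_polar_decomposition_def)
  note bD = positive_op_bounded_clinear[OF D]
  have bS: "bounded_antilinear S" and SS: "\<And>x. S (S x) = x"
    and bJ: "bounded_antilinear J" and JJ: "\<And>x. J (J x) = x"
    using S J by (auto simp: bounded_antilinear_involution_def)
  \<comment> \<open>This presents the inverse as a bounded operator already known to be
    positive.\<close>
  have invD: "inv D = S \<circ> J"
    by (rule inv_equality) (simp_all add: inv_polar(3,4))
  have adjJ: "antilinear_adjoint J = J" by (rule antiunitary_involution_adjoint[OF J nJ])
  have adjS: "antilinear_adjoint S = D \<circ> J"
  proof (rule antilinear_adjoint_unique)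
    fix v w
    have "cinner v (S w) = cinner (J (J v)) (J (D w))" by (simp add: SJD JJ)
    also have "\<dots> = cinner (D w) (J v)" by (rule antilinear_isometry_cinner[OF bJ nJ])
    finally show "cinner v (S w) = cinner w ((D \<circ> J) v)"
      by (simp add: positive_op_symmetric[OF D])
  qed
  \<comment> \<open>The \<open>J\<close> belonging to the given \<open>S\<close> is the reference
    for every \<open>S'\<close>.\<close>
  have ex: "\<exists>C. bounded_clinear C \<and> (\<forall>A. is_crossing tens S' (hs_apply A) (hs_apply (C A)))"
    if "bounded_antilinear_involution S'" for S'
    by (rule ex_crossing_involution[OF tensor J nJ that])
  have crossable: "crossable tens S' T"
    if "hilbert_schmidt T" "bounded_antilinear_involution S'" for T S'
    using ex[OF that(2)] hs_crossing(1)[OF tensor _ that(1)] by blast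
  hence sub: "{T. hilbert_schmidt T} \<subseteq> crossable_ops tens" by (auto simp: crossable_ops_def)

  \<comment> \<open>Crossing with respect to \<open>J\<close>\<close>
  obtain CJ where CJ: "bounded_clinear CJ" "\<And>A. norm (CJ A) \<le> norm A"
    "\<And>A. is_crossing tens J (hs_apply A) (hs_apply (CJ A))"
    using ex_crossing_antiunitary[OF tensor J nJ] by blast
  note hJ = hs_crossing[OF tensor CJ(3)]
  have \<sigma>J: "bounded_antilinear_involution (hs_adjoint \<circ> CJ)"
    by (rule bounded_antilinear_involution_hs_hat[OF tensor J CJ(1,3)])
  \<comment> \<open>A contraction that squares to the identity is isometric.\<close>
  have n\<sigma>: "norm ((hs_adjoint \<circ> CJ) A) = norm A" for A
  proof (rule antisym)
    have le: "norm ((hs_adjoint \<circ> CJ) A) \<le> norm A" for A by (simp add: norm_hs_adjoint CJ(2))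
    show "norm ((hs_adjoint \<circ> CJ) A) \<le> norm A" by (rule le)
    have "(hs_adjoint \<circ> CJ) ((hs_adjoint \<circ> CJ) A) = A"
      using \<sigma>J by (simp only: bounded_antilinear_involution_def)
    thus "norm A \<le> norm ((hs_adjoint \<circ> CJ) A)" using le[of "(hs_adjoint \<circ> CJ) A"] by (simp only:)
  qed
  have b\<sigma>J: "bounded_antilinear (hs_adjoint \<circ> CJ)"
    using \<sigma>J by (simp only: bounded_antilinear_involution_def)
  have unitary: "unitary CJ"
    unfolding unitary_def
  proof (intro conjI allI CJ(1) bij_is_surj bij_of_hs_adjoint_involution \<sigma>J)
    fix A B
    have "cinner (CJ A) (CJ B) = cinner (hs_adjoint (CJ B)) (hs_adjoint (CJ A))"
      by (rule antilinear_isometry_cinner[OF bounded_antilinear_hs_adjoint norm_hs_adjoint, symmetric])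
    also have "\<dots> = cinner A B" using antilinear_isometry_cinner[OF b\<sigma>J n\<sigma>] by simp
    finally show "cinner (CJ A) (CJ B) = cinner A B" .
  qed

  \<comment> \<open>Crossing with respect to \<open>S\<close>\<close>
  obtain CS where CS: "bounded_clinear CS" "\<And>A. is_crossing tens S (hs_apply A) (hs_apply (CS A))"
    using ex[OF S] by blast
  note hS = hs_crossing[OF tensor CS(2)]
  have \<sigma>S: "bounded_antilinear_involution (hs_adjoint \<circ> CS)"
    by (rule bounded_antilinear_involution_hs_hat[OF tensor S CS])
  have bijS: "bij CS" by (rule bij_of_hs_adjoint_involution[OF \<sigma>S])

  \<comment> \<open>Polar decomposition on the Hilbert-Schmidt operators\<close>
  define L where "L = tensor_op tens id D"
  define Q where "Q = tensor_op tens (inv D) id"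
  have pL: "positive_op L" unfolding L_def by (rule positive_op_tensor_right[OF tensor D])
  have pQ: "positive_op Q"
    unfolding Q_def invD by (rule positive_op_tensor_left[OF tensor inv_polar(5)])
  note bL = positive_op_bounded_clinear[OF pL] and bQ = positive_op_bounded_clinear[OF pQ]
  have hat_Delta: "hat_Delta_half tens \<Delta> T = L \<circ> T \<circ> Q" for T
    by (simp add: hat_Delta_half_def L_def Q_def D_def)
  have pres_Delta: "preserves_hilbert_schmidt (hat_Delta_half tens \<Delta>)"
    using preserves_hilbert_schmidt_compose_left[OF bL] preserves_hilbert_schmidt_compose_right[OF bQ]
    unfolding preserves_hilbert_schmidt_def hat_Delta o_assoc[symmetric] by blast
  let ?\<Delta> = "hs_restrict (hat_Delta_half tens \<Delta>)"
  have apply_Delta: "hs_apply (?\<Delta> A) = L \<circ> hs_apply A \<circ> Q" for A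
    by (simp add: hs_apply_hs_restrict[OF pres_Delta] hat_Delta)
  have Delta_eq: "?\<Delta> = hs_restrict ((\<circ>) L) \<circ> hs_restrict (\<lambda>T. T \<circ> Q)"
    by (rule ext, rule hs_op_eqI)
      (simp add: apply_Delta hs_apply_compose_left[OF bL] hs_apply_compose_right[OF bQ])
  have pDelta: "positive_op ?\<Delta>"
    unfolding Delta_eq
  proof (rule positive_op_commuting_compose)
    show "hs_restrict ((\<circ>) L) \<circ> hs_restrict (\<lambda>T. T \<circ> Q) =
        hs_restrict (\<lambda>T. T \<circ> Q) \<circ> hs_restrict ((\<circ>) L)"
      by (rule ext, rule hs_op_eqI)
        (simp add: hs_apply_compose_left[OF bL] hs_apply_compose_right[OF bQ])
  qed (rule positive_op_hs_compose_left[OF pL] positive_op_hs_compose_right[OF pQ])+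
  \<comment> \<open>Here the two correcting operators are positive: \<open>D\<close> sends
    \<open>J y\<close> to the adjoint of \<open>S\<close> at \<open>y\<close>, and
    \<open>inv D\<close> sends \<open>J x\<close> to \<open>S x\<close>.\<close>
  have CSJ: "CS A = CJ (?\<Delta> A)" for A
  proof -
    have "is_crossing tens S (hs_apply A) (hs_apply (CJ (?\<Delta> A)))"
    proof (rule is_crossing_change_involution[OF bL])
      show "cadjoint L (tens x (antilinear_adjoint J y)) = tens x (antilinear_adjoint S y)" for x y
        by (simp add: positive_op_cadjoint[OF pL] adjJ adjS)
          (simp add: L_def tensor_op[OF tensor bounded_clinear_id bD])
      show "Q (tens (J x) y) = tens (S x) y" for x y
        by (simp add: Q_def invD JJ
            tensor_op[OF tensor bounded_antilinear_compose[OF bS bJ] bounded_clinear_id])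
      show "is_crossing tens J (L \<circ> hs_apply A \<circ> Q) (hs_apply (CJ (?\<Delta> A)))"
        using CJ(3)[of "?\<Delta> A"] by (simp only: apply_Delta)
    qed
    from is_crossing_unique[OF tensor CS(2) this] show ?thesis by (simp add: hs_apply_inject)
  qed
  have polar_hat: "antilinear_polar_decomposition (hs_adjoint \<circ> CS) (hs_adjoint \<circ> CJ) ?\<Delta>"
    unfolding antilinear_polar_decomposition_def
  proof (intro conjI b\<sigma>J pDelta)
    show b\<sigma>S: "bounded_antilinear (hs_adjoint \<circ> CS)"
      using \<sigma>S by (simp only: bounded_antilinear_involution_def)
    show "partial_isometry (hs_adjoint \<circ> CJ)" using n\<sigma> by (simp add: partial_isometry_def)
    show fac: "hs_adjoint \<circ> CS = (hs_adjoint \<circ> CJ) \<circ> ?\<Delta>" by (rule ext) (simp add: CSJ)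
    \<comment> \<open>The involution factors through \<open>?\<Delta>\<close>, so its injectivity
      forces that of \<open>?\<Delta>\<close>.\<close>
    have "A = 0" if "?\<Delta> A = 0" for A
    proof -
      have "(hs_adjoint \<circ> CS) A = 0"
        using that linear_0[OF bounded_antilinear_linear[OF b\<sigma>J]] by (simp add: CSJ)
      moreover have "(hs_adjoint \<circ> CS) ((hs_adjoint \<circ> CS) A) = A"
        using \<sigma>S by (simp only: bounded_antilinear_involution_def)
      ultimately show "A = 0"
        using linear_0[OF bounded_antilinear_linear[OF b\<sigma>S]] by (simp only:)
    qed
    moreover have "(hs_adjoint \<circ> CJ) A = 0 \<longleftrightarrow> A = 0" for A
      using n\<sigma>[of A] by (metis norm_eq_zero)
    ultimately show "{A. (hs_adjoint \<circ> CJ) A = 0} = {A. ?\<Delta> A = 0}"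
      using linear_0[OF bounded_clinear_linear[OF positive_op_bounded_clinear[OF pDelta]]] by auto
  qed

  \<comment> \<open>The fixed points as a standard subspace\<close>
  have H: "{A. hs_apply A \<in> hat_H tens S} = {A. (hs_adjoint \<circ> CS) A = A}"
  proof -
    have "hs_apply A \<in> crossable_ops tens" for A using sub hilbert_schmidt_hs_apply by blast
    moreover have "hat tens S (hs_apply A) = hs_apply ((hs_adjoint \<circ> CS) A)" for A
      using hs_apply_hs_restrict[OF hS(4), of A] by (simp only: hS(5))
    ultimately show ?thesis by (simp add: hat_H_def hs_apply_inject)
  qed
  show ?thesis
    unfolding hJ(3,5) hS(3,5) H
    using crossable sub hJ(2,4) hS(2,4) unitary CS(1) bijS pres_Delta polar_hat
      involution_fixed_points_standard[OF \<sigma>S]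
    by blast
qed

end
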